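(* Let $\alpha\ge\beta\ge-1/2$ be real numbers with $\alpha>-1/2$, and let $\mu$ be the measure on $[-1,1]$ given by $d\mu(x)=(1-x)^\alpha(1+x)^\beta\,dx$. Let $p$ and $\delta$ be real numbers with $$1\le p<\frac{4(\alpha+1)}{2\alpha+3}\qquad\text{and}\qquad 0\le\delta<\frac{2\alpha+2}{p}-\frac{2\alpha+3}{2}.$$ Then there is a function $f\in L^p([-1,1],\mu)$, supported in $[0,1]$, such that both the Cesàro means $\sigma_N^\delta f(x)$ (as $N\to\infty$) and the Riesz means $S_r^\delta f(x)$ (as $r\to\infty$) of order $\delta$ of the Jacobi polynomial expansion of $f$ are divergent for almost every $x\in[-1,1]$.
   Context: $P_n^{(\alpha,\beta)}$ denotes the Jacobi polynomial of degree $n$ associated to $(\alpha,\beta)$ in Szegő's normalization, $P_n^{(\alpha,\beta)}(1)=\binom{n+\alpha}{n}$; the sequence $(P_n^{(\alpha,\beta)})_{n\ge0}$ is orthogonal in $L^2([-1,1],\mu)$. Put $h_n^{(\alpha,\beta)}=\int_{-1}^1|P_n^{(\alpha,\beta)}(x)|^2\,d\mu(x)$. For $f\in L^1([-1,1],\mu)$ (which contains $L^p([-1,1],\mu)$ for $p\ge1$ since $\mu$ is finite), the coefficients are $c_n(f)=\int_{-1}^1 f(x)P_n^{(\alpha,\beta)}(x)\,d\mu(x)$ and the Jacobi polynomial expansion of $f$ is $\sum_{n=0}^\infty c_n(f)\,(h_n^{(\alpha,\beta)})^{-1}P_n^{(\alpha,\beta)}(x)$. The Cesàro means of order $\delta$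 of this expansion are $$\sigma_N^\delta f(x)=\sum_{n=0}^N\frac{A_{N-n}^\delta}{A_N^\delta}\,c_n(f)\,(h_n^{(\alpha,\beta)})^{-1}P_n^{(\alpha,\beta)}(x),\qquad A_n^\delta=\binom{n+\delta}{n},\quad N=0,1,2,\dots$$ The Riesz means of order $\delta\ge0$ are, for real $r>0$, $$S_r^\delta f(x)=\sum_{0\le n<r}\left(1-\frac{n}{r}\right)^\delta c_n(f)\,(h_n^{(\alpha,\beta)})^{-1}P_n^{(\alpha,\beta)}(x).$$ "Divergent" means that the means do not converge to a finite limit. "Almost every" is with respect to Lebesgue measure on $[-1,1]$ (equivalently $\mu$). "Supported in $[0,1]$" means $f=0$ almost everywhere on $[-1,0)$. *)

theory Defs
  imports "HOL-Analysis.Analysis"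
begin

text \<open>
  The Jacobi polynomial in the normalization of Szego, by the closed formula
  \[P_n^{(\alpha,\beta)}(x) = \sum_{s=0}^{n} {n+\alpha \choose n-s} {n+\beta \choose s}
    \Bigl(\frac{x-1}{2}\Bigr)^{s} \Bigl(\frac{x+1}{2}\Bigr)^{n-s}\]
  (Szego, Orthogonal Polynomials, (4.3.2)). The lemmas \<open>poly_jacobi_poly_1\<close>,
  \<open>degree_jacobi_poly\<close> and \<open>jacobi_poly_orthogonal\<close> below prove the properties that
  characterize it.
\<close>

definition jacobi_poly :: "real \<Rightarrow> real \<Rightarrow> nat \<Rightarrow> real poly" where
  "jacobi_poly \<alpha> \<beta> n =
    (\<Sum>s\<le>n. smult (((real n + \<alpha>) gchoose (n - s)) * ((real n + \<beta>) gchoose s))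
       ([:- 1 / 2, 1 / 2:] ^ s * [:1 / 2, 1 / 2:] ^ (n - s)))"

definition jacobi_measure :: "real \<Rightarrow> real \<Rightarrow> real measure" where
  "jacobi_measure \<alpha> \<beta> =
    density (restrict_space lborel {-1..1}) (\<lambda>x. ennreal ((1 - x) powr \<alpha> * (1 + x) powr \<beta>))"

text \<open>
  Members of \<open>L\<^sup>p\<close> are represented by functions, not by classes modulo null sets. On
  \<open>jacobi_measure \<alpha> \<beta>\<close> only the values on \<open>{-1..1}\<close> matter.
\<close>

definition Lp_functions :: "real \<Rightarrow> 'a measure \<Rightarrow> ('a \<Rightarrow> real) set" where
  "Lp_functions p M = {f \<in> borel_measurable M. integrable M (\<lambda>x. \<bar>f x\<bar> powr p)}"

definition jacobi_norm_sq :: "real \<Rightarrow> real \<Rightarrow> nat \<Rightarrow> real" where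
  "jacobi_norm_sq \<alpha> \<beta> n = (LINT x|jacobi_measure \<alpha> \<beta>. \<bar>poly (jacobi_poly \<alpha> \<beta> n) x\<bar>\<^sup>2)"

definition jacobi_coeff :: "real \<Rightarrow> real \<Rightarrow> (real \<Rightarrow> real) \<Rightarrow> nat \<Rightarrow> real" where
  "jacobi_coeff \<alpha> \<beta> f n = (LINT x|jacobi_measure \<alpha> \<beta>. f x * poly (jacobi_poly \<alpha> \<beta> n) x)"

definition jacobi_term :: "real \<Rightarrow> real \<Rightarrow> (real \<Rightarrow> real) \<Rightarrow> nat \<Rightarrow> real \<Rightarrow> real" where
  "jacobi_term \<alpha> \<beta> f n x =
    jacobi_coeff \<alpha> \<beta> f n * inverse (jacobi_norm_sq \<alpha> \<beta> n) * poly (jacobi_poly \<alpha> \<beta> n) x"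

definition cesaro_number :: "real \<Rightarrow> nat \<Rightarrow> real" where
  "cesaro_number \<delta> n = (real n + \<delta>) gchoose n"

definition cesaro_mean :: "real \<Rightarrow> real \<Rightarrow> real \<Rightarrow> (real \<Rightarrow> real) \<Rightarrow> nat \<Rightarrow> real \<Rightarrow> real" where
  "cesaro_mean \<alpha> \<beta> \<delta> f N x =
    (\<Sum>n\<le>N. cesaro_number \<delta> (N - n) / cesaro_number \<delta> N * jacobi_term \<alpha> \<beta> f n x)"

text \<open>The base \<open>1 - real n / r\<close> is positive in every summand, so \<open>powr\<close> yields \<open>1\<close> for \<open>\<delta> = 0\<close>.\<close>

definition riesz_mean :: "real \<Rightarrow> real \<Rightarrow> real \<Rightarrow> (real \<Rightarrow> real) \<Rightarrow> real \<Rightarrow> real \<Rightarrow> real" where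
  "riesz_mean \<alpha> \<beta> \<delta> f r x =
    (\<Sum>n | real n < r. (1 - real n / r) powr \<delta> * jacobi_term \<alpha> \<beta> f n x)"


lemma poly_jacobi_poly:
  "poly (jacobi_poly \<alpha> \<beta> n) x =
    (\<Sum>s\<le>n. ((real n + \<alpha>) gchoose (n - s)) * ((real n + \<beta>) gchoose s)
       * ((x - 1) / 2) ^ s * ((x + 1) / 2) ^ (n - s))"
  unfolding jacobi_poly_def poly_sum
  by (intro sum.cong refl) (simp add: diff_divide_distrib add_divide_distrib add.commute)

lemma poly_jacobi_poly_1: "poly (jacobi_poly \<alpha> \<beta> n) 1 = (real n + \<alpha>) gchoose n"
proof -
  have "poly (jacobi_poly \<alpha> \<beta> n) 1 =
    (\<Sum>s\<le>n. if s = 0 then (real n + \<alpha>) gchoose n else 0)"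
    unfolding poly_jacobi_poly by (intro sum.cong) auto
  then show ?thesis by simp
qed

lemma degree_jacobi_poly:
  assumes "\<alpha> > -1" "\<beta> > -1"
  shows "degree (jacobi_poly \<alpha> \<beta> n) = n"
proof -
  let ?q = "\<lambda>s. [:- 1 / 2, 1 / 2:] ^ s * [:1 / 2, 1 / 2:] ^ (n - s) :: real poly"
  have deg: "degree (?q s) = n" if "s \<le> n" for s
    using that by (simp add: degree_mult_eq degree_power_eq)
  have lc: "coeff (?q s) n = (1 / 2) ^ n" if "s \<le> n" for s
  proof -
    have "coeff (?q s) n = lead_coeff (?q s)" using deg[OF that] by simp
    also have "\<dots> = (1 / 2) ^ s * (1 / 2) ^ (n - s)"
      unfolding lead_coeff_mult lead_coeff_power by simp
    also have "\<dots> = (1 / 2) ^ n" using that by (simp flip: power_add)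
    finally show ?thesis .
  qed
  have "coeff (jacobi_poly \<alpha> \<beta> n) n =
    (\<Sum>s\<le>n. ((real n + \<alpha>) gchoose (n - s)) * ((real n + \<beta>) gchoose s) * (1 / 2) ^ n)"
    unfolding jacobi_poly_def coeff_sum coeff_smult
    by (intro sum.cong refl) (simp only: lc atMost_iff)
  also have "\<dots> = (\<Sum>s = 0..n. ((real n + \<beta>) gchoose s) * ((real n + \<alpha>) gchoose (n - s))) * (1 / 2) ^ n"
    by (simp add: sum_distrib_left sum_distrib_right atMost_atLeast0 mult_ac)
  also have "\<dots> = ((2 * real n + \<alpha> + \<beta>) gchoose n) * (1 / 2) ^ n"
    unfolding gbinomial_Vandermonde by (simp add: algebra_simps)
  finally have c: "coeff (jacobi_poly \<alpha> \<beta> n) n = ((2 * real n + \<alpha> + \<beta>) gchoose n) * (1 / 2) ^ n" .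
  have "(\<Prod>i = 0..<n. 2 * real n + \<alpha> + \<beta> - real i) > 0"
  proof (rule prod_pos)
    fix i assume "i \<in> {0..<n}"
    then have "real i + 1 \<le> real n" by auto
    then show "0 < 2 * real n + \<alpha> + \<beta> - real i" using assms by linarith
  qed
  then have "(\<Prod>i = 0..<n. 2 * real n + \<alpha> + \<beta> - real i) \<noteq> 0" by (metis less_irrefl)
  then have "coeff (jacobi_poly \<alpha> \<beta> n) n \<noteq> 0"
    unfolding c gbinomial_prod_rev by simp
  then have "n \<le> degree (jacobi_poly \<alpha> \<beta> n)" by (rule le_degree)
  moreover have "degree (jacobi_poly \<alpha> \<beta> n) \<le> n"
    unfolding jacobi_poly_def
    by (intro degree_sum_le finite_atMost order_trans[OF degree_smult_le]) (simp only: deg atMost_iff)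
  ultimately show ?thesis by simp
qed

lemma jacobi_weight_integral:
  fixes a b :: real
  assumes "a > -1" "b > -1"
  shows "has_bochner_integral (restrict_space lborel {-1..1})
    (\<lambda>x. (1 - x) powr a * (1 + x) powr b) (2 powr (a + b + 1) * Beta (a + 1) (b + 1))"
proof -
  let ?g = "\<lambda>x::real. (1 - x) powr a * (1 + x) powr b"
  have "((\<lambda>t. t powr b * (1 - t) powr a) has_integral Beta (b + 1) (a + 1)) (cbox 0 1)"
    using has_integral_Beta_real[of "b + 1" "a + 1"] assms by simp
  from has_integral_affinity'[OF this, of "1/2" "1/2"]
  have "((\<lambda>x. (x / 2 + 1 / 2) powr b * (1 - (x / 2 + 1 / 2)) powr a) has_integral 2 * Beta (b + 1) (a + 1)) {-1..1}"
    by simp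
  from has_integral_mult_right[OF this, of "2 powr (a + b)"]
  have 1: "((\<lambda>x. 2 powr (a + b) * ((x / 2 + 1 / 2) powr b * (1 - (x / 2 + 1 / 2)) powr a))
    has_integral 2 powr (a + b + 1) * Beta (a + 1) (b + 1)) {-1..1}"
    by (simp add: powr_add Beta_commute mult_ac)
  have "?g x = 2 powr (a + b) * ((x / 2 + 1 / 2) powr b * (1 - (x / 2 + 1 / 2)) powr a)"
    if "x \<in> {-1..1}" for x
  proof -
    have "(1 - x) powr a = 2 powr a * (1 - (x / 2 + 1 / 2)) powr a"
    proof -
      have "1 - x = 2 * (1 - (x / 2 + 1 / 2))" by (simp add: field_simps)
      then show ?thesis using that powr_mult[of 2 "1 - (x / 2 + 1 / 2)" a] by simp
    qed
    moreover have "(1 + x) powr b = 2 powr b * (x / 2 + 1 / 2) powr b"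
    proof -
      have "1 + x = 2 * (x / 2 + 1 / 2)" by (simp add: field_simps)
      then show ?thesis using that powr_mult[of 2 "x / 2 + 1 / 2" b] by (simp add: add.commute)
    qed
    ultimately show ?thesis by (simp add: powr_add mult_ac)
  qed
  then have 2: "(?g has_integral 2 powr (a + b + 1) * Beta (a + 1) (b + 1)) {-1..1}"
    using 1 by (subst has_integral_cong)
  then have "?g absolutely_integrable_on {-1..1}"
    by (intro nonnegative_absolutely_integrable_1) (auto simp: integrable_on_def)
  then have 3: "set_integrable lebesgue {-1..1} ?g" .
  have 4: "(\<lambda>x. indicator {-1..1} x *\<^sub>R ?g x) \<in> borel_measurable lborel" by measurable
  have "integrable lborel (\<lambda>x. indicator {-1..1} x *\<^sub>R ?g x)"
    using 3 4 by (simp add: set_integrable_def integrable_completion)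
  moreover have "(LINT x|lborel. indicator {-1..1} x *\<^sub>R ?g x) = 2 powr (a + b + 1) * Beta (a + 1) (b + 1)"
    using set_lebesgue_integral_eq_integral(2)[OF 3] integral_unique[OF 2] integral_completion[OF 4]
    by (simp add: set_lebesgue_integral_def)
  ultimately show ?thesis
    by (simp add: has_bochner_integral_iff integrable_restrict_space integral_restrict_space)
qed

lemma jacobi_measure_integral_mult:
  assumes "f \<in> borel_measurable borel"
  shows "integrable (jacobi_measure \<alpha> \<beta>) f \<longleftrightarrow>
      integrable (restrict_space lborel {-1..1}) (\<lambda>x. (1 - x) powr \<alpha> * (1 + x) powr \<beta> * f x)"
    and "(LINT x|jacobi_measure \<alpha> \<beta>. f x) =
      (LINT x|restrict_space lborel {-1..1}. (1 - x) powr \<alpha> * (1 + x) powr \<beta> * f x)"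
proof -
  have [measurable]: "f \<in> borel_measurable (restrict_space lborel {-1..1})"
    using assms by (intro measurable_restrict_space1) simp
  have [measurable]: "(\<lambda>x. (1 - x) powr \<alpha> * (1 + x) powr \<beta>) \<in> borel_measurable (restrict_space lborel {-1..1})"
    by (intro measurable_restrict_space1) measurable
  show "integrable (jacobi_measure \<alpha> \<beta>) f \<longleftrightarrow>
      integrable (restrict_space lborel {-1..1}) (\<lambda>x. (1 - x) powr \<alpha> * (1 + x) powr \<beta> * f x)"
    unfolding jacobi_measure_def by (subst integrable_density) auto
  show "(LINT x|jacobi_measure \<alpha> \<beta>. f x) =
      (LINT x|restrict_space lborel {-1..1}. (1 - x) powr \<alpha> * (1 + x) powr \<beta> * f x)"
    unfolding jacobi_measure_def by (subst integral_density) auto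
qed

lemma jacobi_monomial_integral:
  fixes \<alpha> \<beta> :: real
  assumes "\<alpha> > -1" "\<beta> > -1"
  shows "has_bochner_integral (jacobi_measure \<alpha> \<beta>) (\<lambda>x. (1 - x) ^ i * (1 + x) ^ j)
    (2 powr (\<alpha> + \<beta> + real i + real j + 1) * Beta (\<alpha> + real i + 1) (\<beta> + real j + 1))"
proof -
  let ?M = "restrict_space lborel {-1..1::real}"
  have eq: "AE x in ?M. (1 - x) powr (\<alpha> + real i) * (1 + x) powr (\<beta> + real j)
      = (1 - x) powr \<alpha> * (1 + x) powr \<beta> * ((1 - x) ^ i * (1 + x) ^ j)"
  proof -
    have "AE x in lborel. x \<noteq> -1 \<and> x \<noteq> (1::real)"
      using AE_lborel_singleton[of "-1::real"] AE_lborel_singleton[of "1::real"] by eventually_elim auto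
    then have "AE x in lborel. x \<in> {-1..1} \<longrightarrow> (1 - x) powr (\<alpha> + real i) * (1 + x) powr (\<beta> + real j)
      = (1 - x) powr \<alpha> * (1 + x) powr \<beta> * ((1 - x) ^ i * (1 + x) ^ j)"
      by eventually_elim (auto simp: powr_add powr_realpow)
    then show ?thesis by (subst AE_restrict_space_iff) auto
  qed
  have m1: "(\<lambda>x. (1 - x) powr (\<alpha> + real i) * (1 + x) powr (\<beta> + real j)) \<in> borel_measurable ?M"
    by (intro measurable_restrict_space1) measurable
  have m2: "(\<lambda>x. (1 - x) powr \<alpha> * (1 + x) powr \<beta> * ((1 - x) ^ i * (1 + x) ^ j)) \<in> borel_measurable ?M"
    by (intro measurable_restrict_space1) measurable
  have m3: "(\<lambda>x::real. (1 - x) ^ i * (1 + x) ^ j) \<in> borel_measurable borel" by measurable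
  have "has_bochner_integral ?M (\<lambda>x. (1 - x) powr \<alpha> * (1 + x) powr \<beta> * ((1 - x) ^ i * (1 + x) ^ j))
    (2 powr (\<alpha> + real i + (\<beta> + real j) + 1) * Beta (\<alpha> + real i + 1) (\<beta> + real j + 1))"
    using jacobi_weight_integral[of "\<alpha> + real i" "\<beta> + real j"] assms
      has_bochner_integralI_AE[OF _ m2 eq] by (simp add: has_bochner_integral_cong_AE[OF m1 m2 eq])
  then show ?thesis
    unfolding has_bochner_integral_iff jacobi_measure_integral_mult[OF m3] by (simp add: add_ac)
qed

lemma alternating_sum_pochhammer:
  fixes a :: real
  assumes "k < n"
  shows "(\<Sum>s\<le>n. (-1) ^ s * real (n choose s) * pochhammer (a + real s) k) = 0"
  using assms
proof (induction n arbitrary: k a)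
  case 0
  then show ?case by simp
next
  case (Suc n)
  let ?f = "\<lambda>s. pochhammer (a + real s) k"
  have "(\<Sum>s\<le>Suc n. (-1) ^ s * real (Suc n choose s) * ?f s)
      = ?f 0 + (\<Sum>s\<le>n. (-1) ^ Suc s * real (n choose Suc s) * ?f (Suc s))
        + (\<Sum>s\<le>n. (-1) ^ Suc s * real (n choose s) * ?f (Suc s))"
    by (subst sum.atMost_Suc_shift) (simp add: ring_distribs sum_subtractf sum_negf)
  also have "?f 0 + (\<Sum>s\<le>n. (-1) ^ Suc s * real (n choose Suc s) * ?f (Suc s))
      = (\<Sum>s\<le>Suc n. (-1) ^ s * real (n choose s) * ?f s)"
    by (subst sum.atMost_Suc_shift) simp
  also have "\<dots> = (\<Sum>s\<le>n. (-1) ^ s * real (n choose s) * ?f s)" by simp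
  finally have *: "(\<Sum>s\<le>Suc n. (-1) ^ s * real (Suc n choose s) * ?f s)
      = (\<Sum>s\<le>n. (-1) ^ s * real (n choose s) * (?f s - ?f (Suc s)))"
    by (simp add: right_diff_distrib sum_negf sum_subtractf)
  show ?case
  proof (cases k)
    case 0
    then show ?thesis unfolding * by simp
  next
    case (Suc m)
    have "?f s - ?f (Suc s) = - real k * pochhammer (a + 1 + real s) m" for s
      unfolding Suc pochhammer_rec[of "a + real s"] pochhammer_Suc[of "a + real (Suc s)"]
      by (simp add: algebra_simps)
    then have "(\<Sum>s\<le>n. (-1) ^ s * real (n choose s) * (?f s - ?f (Suc s)))
      = - real k * (\<Sum>s\<le>n. (-1) ^ s * real (n choose s) * pochhammer (a + 1 + real s) m)"
      by (simp add: sum_distrib_left mult_ac)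
    then show ?thesis unfolding * using Suc.IH[of m "a + 1"] Suc.prems \<open>k = Suc m\<close> by simp
  qed
qed

lemma jacobi_poly_orthogonal_power:
  fixes \<alpha> \<beta> :: real
  assumes ab: "\<alpha> > -1" "\<beta> > -1" and "k < n"
  shows "has_bochner_integral (jacobi_measure \<alpha> \<beta>)
    (\<lambda>x. poly (jacobi_poly \<alpha> \<beta> n) x * (1 - x) ^ k) 0"
proof -
  let ?c = "\<lambda>s. ((real n + \<alpha>) gchoose (n - s)) * ((real n + \<beta>) gchoose s) * (-1) ^ s / 2 ^ n"
  let ?v = "\<lambda>s. 2 powr (\<alpha> + \<beta> + real (s + k) + real (n - s) + 1)
    * Beta (\<alpha> + real (s + k) + 1) (\<beta> + real (n - s) + 1)"
  have fn: "poly (jacobi_poly \<alpha> \<beta> n) x * (1 - x) ^ k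
      = (\<Sum>s\<le>n. ?c s * ((1 - x) ^ (s + k) * (1 + x) ^ (n - s)))" for x
    unfolding poly_jacobi_poly sum_distrib_right
  proof (intro sum.cong refl)
    fix s assume "s \<in> {..n}"
    then have 1: "(2::real) ^ n = 2 ^ s * 2 ^ (n - s)" by (simp flip: power_add)
    have 2: "((x - 1) / 2) ^ s = (-1) ^ s * (1 - x) ^ s / 2 ^ s"
      by (simp add: power_divide flip: power_mult_distrib)
    show "((real n + \<alpha>) gchoose (n - s)) * ((real n + \<beta>) gchoose s)
       * ((x - 1) / 2) ^ s * ((x + 1) / 2) ^ (n - s) * (1 - x) ^ k
       = ?c s * ((1 - x) ^ (s + k) * (1 + x) ^ (n - s))"
      unfolding 1 2 by (simp add: power_divide power_add add.commute)
  qed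
  have I: "has_bochner_integral (jacobi_measure \<alpha> \<beta>)
    (\<lambda>x. \<Sum>s\<le>n. ?c s * ((1 - x) ^ (s + k) * (1 + x) ^ (n - s))) (\<Sum>s\<le>n. ?c s * ?v s)"
    by (intro has_bochner_integral_sum has_bochner_integral_mult_right jacobi_monomial_integral ab)
  define C where "C = 2 powr (\<alpha> + \<beta> + real k + real n + 1) / 2 ^ n
    * (Gamma (real n + \<alpha> + 1) * Gamma (real n + \<beta> + 1) / (fact n * Gamma (\<alpha> + \<beta> + real k + real n + 2)))"
  have "?c s * ?v s = C * ((-1) ^ s * real (n choose s) * pochhammer (\<alpha> + 1 + real s) k)"
    if "s \<le> n" for s
  proof -
    have pos: "\<alpha> + real s + 1 > 0" "\<beta> + real (n - s) + 1 > 0" using ab by linarith+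
    have np: "real n + \<alpha> + 1 \<notin> \<int>\<^sub>\<le>\<^sub>0" "real n + \<beta> + 1 \<notin> \<int>\<^sub>\<le>\<^sub>0" "\<alpha> + 1 + real s \<notin> \<int>\<^sub>\<le>\<^sub>0"
      using ab by (auto elim!: nonpos_Ints_cases)
    have g1: "((real n + \<alpha>) gchoose (n - s)) = Gamma (real n + \<alpha> + 1) / (fact (n - s) * Gamma (\<alpha> + real s + 1))"
      using gbinomial_Gamma[of "real n + \<alpha>" "n - s"] np that by (simp add: of_nat_diff algebra_simps)
    have g2: "((real n + \<beta>) gchoose s) = Gamma (real n + \<beta> + 1) / (fact s * Gamma (\<beta> + real (n - s) + 1))"
      using gbinomial_Gamma[of "real n + \<beta>" s] np that by (simp add: of_nat_diff algebra_simps)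
    have g3: "Gamma (\<alpha> + real (s + k) + 1) = pochhammer (\<alpha> + 1 + real s) k * Gamma (\<alpha> + real s + 1)"
      using pochhammer_Gamma[OF np(3), of k] Gamma_real_pos[OF pos(1)] by (simp add: field_simps add_ac)
    have g4: "real (n choose s) = fact n / (fact s * fact (n - s))"
      using binomial_fact[OF that, where 'a = real] .
    have g5: "\<alpha> + \<beta> + real (s + k) + real (n - s) + 1 = \<alpha> + \<beta> + real k + real n + 1"
      "\<alpha> + real (s + k) + 1 + (\<beta> + real (n - s) + 1) = \<alpha> + \<beta> + real k + real n + 2"
      using that by (auto simp: of_nat_diff)
    show ?thesis
      unfolding Beta_def g5 g1 g2 g3 g4 C_def
      using Gamma_real_pos[OF pos(1)] Gamma_real_pos[OF pos(2)] by (simp add: field_simps)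
  qed
  then have "(\<Sum>s\<le>n. ?c s * ?v s)
      = C * (\<Sum>s\<le>n. (-1) ^ s * real (n choose s) * pochhammer (\<alpha> + 1 + real s) k)"
    unfolding sum_distrib_left by (intro sum.cong) auto
  also have "\<dots> = 0" using alternating_sum_pochhammer[OF \<open>k < n\<close>] by simp
  finally show ?thesis using I unfolding fn by simp
qed

lemma jacobi_poly_orthogonal:
  fixes \<alpha> \<beta> :: real
  assumes ab: "\<alpha> > -1" "\<beta> > -1" and "degree q < n"
  shows "has_bochner_integral (jacobi_measure \<alpha> \<beta>)
    (\<lambda>x. poly (jacobi_poly \<alpha> \<beta> n) x * poly q x) 0"
proof -
  define r where "r = pcompose q [:1, -1:]"
  have "degree r < n" using assms(3) by (simp add: r_def degree_pcompose)
  have "poly q x = poly r (1 - x)" for x by (simp add: r_def poly_pcompose)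
  then have "poly (jacobi_poly \<alpha> \<beta> n) x * poly q x
    = (\<Sum>k\<le>degree r. coeff r k * (poly (jacobi_poly \<alpha> \<beta> n) x * (1 - x) ^ k))" for x
    by (simp add: poly_altdef[of r] sum_distrib_left mult_ac)
  moreover have "has_bochner_integral (jacobi_measure \<alpha> \<beta>)
    (\<lambda>x. \<Sum>k\<le>degree r. coeff r k * (poly (jacobi_poly \<alpha> \<beta> n) x * (1 - x) ^ k))
    (\<Sum>k\<le>degree r. coeff r k * 0)"
    using \<open>degree r < n\<close>
    by (intro has_bochner_integral_sum has_bochner_integral_mult_right jacobi_poly_orthogonal_power ab) auto
  ultimately show ?thesis by simp
qed

end

theory Submission
  imports Defs
begin

text \<open>
  Choose \<open>\<gamma>\<close> with \<open>\<gamma> p < \<alpha> + 1\<close> and \<open>\<delta> < 2 \<gamma> - \<alpha> - 3 / 2\<close> and let \<open>f\<close> be \<open>(1 - x) powr (- \<gamma>)\<close> cut off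
  to \<open>[0,1]\<close>. Without the cut-off the coefficients are explicit and of size \<open>n powr (2 \<gamma> - \<alpha> - 2)\<close>. The
  removed part is bounded, so it changes them by \<open>O(sqrt h\<^sub>n)\<close>, where \<open>h\<^sub>n\<close> is of size \<open>1 / n\<close>. Hence
  \<open>c\<^sub>n(f)\<close> is not \<open>O(n powr \<delta> * sqrt h\<^sub>n)\<close>. Convergence of the Cesaro or the Riesz means at \<open>x\<close> makes
  the \<open>n\<close>-th term of the expansion \<open>O(n powr \<delta>)\<close>. If this happened on a set of positive measure, it
  would hold uniformly on a compact set of positive measure. There the Jacobi polynomials oscillate
  like \<open>cos (N \<theta> + \<phi>)\<close>, \<open>x = cos \<theta>\<close>, and carry a fixed proportion of their norm, so the coefficients
  would be \<open>O(n powr \<delta> * sqrt h\<^sub>n)\<close> (the Cantor--Lebesgue argument).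
\<close>

text \<open>Divergence asks that the exponent 2 \<gamma> - \<alpha> - 2 of the coefficients exceed
  \<delta> - 1/2, and membership in L^p asks that \<gamma> < (\<alpha> + 1) / p; the bound on
  \<delta> is exactly what leaves room for such a \<gamma>. The obstacle is the amplitude of the
  polynomials. On a compact part of the open interval the differential equation determines
  \<open>P\<^sub>n\<close> only up to amplitude and phase, and does not relate its size to
  \<open>sqrt h\<^sub>n\<close>. No asymptotic formula is used for either. The phase drops out,
  because the supremum over a set of positive measure is compared with the supremum over the whole
  interval, uniformly over all solutions of the same kind of equation. The amplitude comes from an
  integral identity, which forces \<open>P\<^sub>n\<close> squared to reach a fixed multiple of
  \<open>h\<^sub>n\<close> somewhere in a fixed subinterval. Both facts hold for each large n
  separately, so a single term of the expansion already bounds its own coefficient.\<close>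

lemma pos_not_nonpos_Int: "(z::real) > 0 \<Longrightarrow> z \<notin> \<int>\<^sub>\<le>\<^sub>0"
  by (auto elim!: nonpos_Ints_cases)

lemma LIMSEQ_bounded_real:
  fixes X :: "nat \<Rightarrow> real"
  assumes "X \<longlonglongrightarrow> L"
  obtains B where "\<And>n. \<bar>X n\<bar> \<le> B"
  using convergent_imp_Bseq[OF convergentI[OF assms]] unfolding Bseq_def real_norm_def by blast

text \<open>Euler's limit formula for Gamma, inverted. As \<open>fact (n - 1)\<close> is Gamma(n),
  it says that Gamma(n + z) / Gamma(n) behaves like n^z; the sizes of the Cesaro numbers, of the
  norms and of the coefficients all come from it.\<close>

lemma Gamma_shift_tendsto:
  fixes z :: real
  assumes "z > 0"
  shows "(\<lambda>n. Gamma (real n + z) / (fact (n - 1) * real n powr z)) \<longlonglongrightarrow> 1"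
proof -
  have G: "Gamma z > 0" using assms by (rule Gamma_real_pos)
  have "(\<lambda>n. Gamma z / Gamma_series' z n) \<longlonglongrightarrow> Gamma z / Gamma z"
    using G by (intro tendsto_intros Gamma_series'_LIMSEQ) auto
  moreover have "eventually (\<lambda>n. Gamma z / Gamma_series' z n
      = Gamma (real n + z) / (fact (n - 1) * real n powr z)) sequentially"
    using eventually_gt_at_top[of 0]
  proof eventually_elim
    case (elim n)
    have "pochhammer z n = Gamma (real n + z) / Gamma z"
      by (simp add: pochhammer_Gamma pos_not_nonpos_Int[OF assms] add.commute)
    moreover have "Gamma (real n + z) > 0" using assms by (intro Gamma_real_pos) simp
    ultimately show ?case
      using G elim by (simp add: Gamma_series'_def powr_def mult.commute)
  qed
  ultimately show ?thesis using G by (simp add: Lim_transform_eventually)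
qed

subsection \<open>Size of the terms of a series with bounded means\<close>

lemma cesaro_number_Gamma:
  assumes "\<delta> \<ge> 0"
  shows "cesaro_number \<delta> n = Gamma (real n + (\<delta> + 1)) / (Gamma (\<delta> + 1) * fact n)"
proof -
  have "\<delta> + 1 \<notin> \<int>\<^sub>\<le>\<^sub>0" using assms by (intro pos_not_nonpos_Int) simp
  then show ?thesis
    unfolding cesaro_number_def gbinomial_pochhammer'
    by (simp add: pochhammer_Gamma add_ac)
qed

lemma cesaro_number_pos: "\<delta> \<ge> 0 \<Longrightarrow> cesaro_number \<delta> n > 0"
  by (simp add: cesaro_number_Gamma Gamma_real_pos)

lemma cesaro_number_mono:
  assumes "\<delta> \<ge> 0" "m \<le> n"
  shows "cesaro_number \<delta> m \<le> cesaro_number \<delta> n"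
  using assms(2)
proof (induction rule: dec_induct)
  case (step n)
  have "Gamma (real (Suc n) + (\<delta> + 1)) = (real n + (\<delta> + 1)) * Gamma (real n + (\<delta> + 1))"
    using Gamma_plus1[OF pos_not_nonpos_Int, of "real n + (\<delta> + 1)"] assms(1) by (simp add: add_ac)
  then have "cesaro_number \<delta> (Suc n) = cesaro_number \<delta> n * ((real n + 1 + \<delta>) / (real n + 1))"
    unfolding cesaro_number_Gamma[OF assms(1)] by (simp add: field_simps)
  also have "\<dots> \<ge> cesaro_number \<delta> n * 1"
    using assms(1) cesaro_number_pos[OF assms(1), of n] by (intro mult_left_mono) auto
  finally show ?case using step by simp
qed simp

lemma cesaro_number_le_powr:
  assumes "\<delta> \<ge> 0"
  obtains C where "\<And>n. n \<ge> 1 \<Longrightarrow> cesaro_number \<delta> n \<le> C * real n powr \<delta>"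
proof -
  let ?g = "\<lambda>n. Gamma (real n + (\<delta> + 1)) / (fact (n - 1) * real n powr (\<delta> + 1))"
  obtain B where B: "\<And>n. \<bar>?g n\<bar> \<le> B"
    using LIMSEQ_bounded_real[OF Gamma_shift_tendsto[of "\<delta> + 1"]] assms by auto
  have "cesaro_number \<delta> n \<le> B / Gamma (\<delta> + 1) * real n powr \<delta>" if "n \<ge> 1" for n
  proof -
    have G: "Gamma (\<delta> + 1) > 0" using assms by (intro Gamma_real_pos) simp
    have "(fact n :: real) = real n * fact (n - 1)" using that by (simp add: fact_reduce)
    then have "cesaro_number \<delta> n = ?g n / Gamma (\<delta> + 1) * real n powr \<delta>"
      using that G by (simp add: cesaro_number_Gamma[OF assms] powr_add field_simps)
    also have "\<dots> \<le> B / Gamma (\<delta> + 1) * real n powr \<delta>"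
      using B[of n, THEN abs_le_D1] G by (intro mult_right_mono divide_right_mono) auto
    finally show ?thesis .
  qed
  then show ?thesis by (rule that)
qed

text \<open>The binomial coefficients decay like k^(- s - 1). For s = \<delta> + 1 they are, up to
  sign, the power series coefficients of (1 - z)^(\<delta> + 1).\<close>

lemma summable_abs_gbinomial:
  fixes s :: real
  assumes "s > 0"
  shows "summable (\<lambda>k. \<bar>s gchoose k\<bar>)"
proof -
  let ?q = "\<lambda>n. (s gchoose n) / ((-1) ^ n / exp ((s + 1) * of_real (ln (real n))))"
  obtain B where B: "\<And>n. \<bar>?q n\<bar> \<le> B"
    using LIMSEQ_bounded_real[OF gbinomial_asymptotic[of s]] by blast
  have "summable (\<lambda>n. B * real n powr (- (s + 1)))"
    using assms by (intro summable_mult) (simp add: summable_real_powr_iff)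
  then show ?thesis
  proof (rule summable_comparison_test_ev[rotated])
    show "eventually (\<lambda>k. norm \<bar>s gchoose k\<bar> \<le> B * real k powr - (s + 1)) sequentially"
      using eventually_gt_at_top[of 0]
    proof eventually_elim
      case (elim n)
      have "\<bar>?q n\<bar> = \<bar>s gchoose n\<bar> * real n powr (s + 1)"
        using elim by (simp add: abs_mult powr_def)
      then have "\<bar>s gchoose n\<bar> * real n powr (s + 1) \<le> B" using B[of n] by simp
      then show ?case
        using elim unfolding powr_minus by (simp add: field_simps)
    qed
  qed
qed

text \<open>
  The generating function of the numbers \<open>A\<^sub>n\<^sup>\<delta>\<close> is \<open>(1 - z) powr (- \<delta> - 1)\<close>, and the coefficients
  of its inverse are absolutely summable.
\<close>

lemma bounded_cesaro_means_terms:
  fixes t :: "nat \<Rightarrow> real"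
  assumes "\<delta> \<ge> 0"
    and K: "\<And>N. \<bar>\<Sum>n\<le>N. cesaro_number \<delta> (N - n) / cesaro_number \<delta> N * t n\<bar> \<le> K"
  obtains C where "\<And>n. n \<ge> 1 \<Longrightarrow> \<bar>t n\<bar> \<le> C * real n powr \<delta>"
proof -
  define b where "b k = (-1) ^ k * ((\<delta> + 1) gchoose k)" for k
  define S where "S N = (\<Sum>n\<le>N. cesaro_number \<delta> (N - n) * t n)" for N
  have A: "cesaro_number \<delta> n = (-1) ^ n * ((- (\<delta> + 1)) gchoose n)" for n
    unfolding cesaro_number_def by (subst gbinomial_negated_upper) simp
  have ba: "Abs_fps b * Abs_fps (cesaro_number \<delta>) = 1"
  proof (rule fps_ext)
    fix m
    have "fps_nth (Abs_fps b * Abs_fps (cesaro_number \<delta>)) m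
        = (\<Sum>k=0..m. (-1) ^ m * (((\<delta> + 1) gchoose k) * ((- (\<delta> + 1)) gchoose (m - k))))"
      unfolding fps_mult_nth fps_nth_Abs_fps b_def A
      by (intro sum.cong refl) (simp add: mult_ac flip: power_add)
    also have "\<dots> = (-1) ^ m * ((0::real) gchoose m)"
      unfolding sum_distrib_left[symmetric] gbinomial_Vandermonde by simp
    finally show "fps_nth (Abs_fps b * Abs_fps (cesaro_number \<delta>)) m = fps_nth 1 m"
      by (cases m) simp_all
  qed
  have S: "Abs_fps S = Abs_fps (cesaro_number \<delta>) * Abs_fps t"
    by (subst mult.commute, rule fps_ext)
       (simp add: fps_mult_nth S_def atMost_atLeast0 mult.commute)
  have t: "t N = (\<Sum>k\<le>N. b k * S (N - k))" for N
  proof -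
    have "Abs_fps t = Abs_fps b * Abs_fps S" unfolding S mult.assoc[symmetric] ba by simp
    then have "fps_nth (Abs_fps t) N = fps_nth (Abs_fps b * Abs_fps S) N" by simp
    then show ?thesis by (simp add: fps_mult_nth atMost_atLeast0)
  qed
  have K0: "K \<ge> 0" using K[of 0] by linarith
  \<comment> \<open>Monotonicity of the Cesaro numbers bounds all earlier sums by the number of the
    last index, so that the inversion formula \<open>t\<close> costs only the total mass of
    \<open>b\<close>.\<close>
  have Sb: "\<bar>S M\<bar> \<le> K * cesaro_number \<delta> N" if "M \<le> N" for M N
  proof -
    have p: "cesaro_number \<delta> M > 0" by (rule cesaro_number_pos[OF assms(1)])
    have "(\<Sum>n\<le>M. cesaro_number \<delta> (M - n) / cesaro_number \<delta> M * t n) = S M / cesaro_number \<delta> M"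
      by (simp add: S_def sum_divide_distrib)
    then have "\<bar>S M\<bar> \<le> K * cesaro_number \<delta> M"
      using K[of M] p by (simp add: abs_divide pos_divide_le_eq)
    also have "\<dots> \<le> K * cesaro_number \<delta> N"
      by (intro mult_left_mono cesaro_number_mono assms that K0)
    finally show ?thesis .
  qed
  have sb: "summable (\<lambda>k. \<bar>b k\<bar>)"
    using summable_abs_gbinomial[of "\<delta> + 1"] assms(1) by (simp add: b_def abs_mult)
  define B where "B = (\<Sum>k. \<bar>b k\<bar>)"
  have B0: "B \<ge> 0" unfolding B_def using sb by (intro suminf_nonneg) auto
  obtain C where C: "\<And>n. n \<ge> 1 \<Longrightarrow> cesaro_number \<delta> n \<le> C * real n powr \<delta>"
    using cesaro_number_le_powr[OF assms(1)] by blast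
  show thesis
  proof (rule that[of "B * K * C"])
    fix n :: nat assume n: "n \<ge> 1"
    have "\<bar>t n\<bar> \<le> (\<Sum>k\<le>n. \<bar>b k * S (n - k)\<bar>)" unfolding t[of n] by (rule sum_abs)
    also have "\<dots> \<le> (\<Sum>k\<le>n. \<bar>b k\<bar> * (K * cesaro_number \<delta> n))"
      unfolding abs_mult by (intro sum_mono mult_left_mono Sb) auto
    also have "\<dots> = (\<Sum>k\<le>n. \<bar>b k\<bar>) * (K * cesaro_number \<delta> n)" by (simp add: sum_distrib_right)
    also have "\<dots> \<le> B * (K * cesaro_number \<delta> n)"
      unfolding B_def using sb K0 cesaro_number_pos[OF assms(1), of n]
      by (intro mult_right_mono sum_le_suminf) auto
    also have "\<dots> \<le> B * (K * (C * real n powr \<delta>))"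
      using C[OF n] B0 K0 by (intro mult_left_mono) auto
    finally show "\<bar>t n\<bar> \<le> B * K * C * real n powr \<delta>" by (simp add: mult_ac)
  qed
qed

text \<open>Backward, because iterating it at x samples only x and points to its left. The Riesz sum
  of the terms up to m is controlled exactly on such a left half-line.\<close>

definition bdiff :: "real \<Rightarrow> (real \<Rightarrow> real) \<Rightarrow> real \<Rightarrow> real" where
  "bdiff h f x = f x - f (x - h)"

lemma funpow_bdiff_Suc: "(bdiff h ^^ Suc k) f = (bdiff h ^^ k) (bdiff h f)"
  by (simp only: funpow_Suc_right o_apply)

lemma funpow_bdiff_le:
  assumes "h \<ge> 0" "\<And>y. y \<le> x \<Longrightarrow> \<bar>f y\<bar> \<le> B"
  shows "\<bar>(bdiff h ^^ k) f x\<bar> \<le> 2 ^ k * B"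
  using assms(2)
proof (induction k arbitrary: f B)
  case (Suc k)
  have "\<bar>bdiff h f y\<bar> \<le> 2 * B" if "y \<le> x" for y
    using Suc.prems[OF that] Suc.prems[of "y - h"] that assms(1) unfolding bdiff_def by linarith
  from Suc.IH[OF this] show ?case unfolding funpow_bdiff_Suc by (simp add: mult_ac)
qed simp

lemma funpow_bdiff_sum:
  "(bdiff h ^^ k) (\<lambda>x. \<Sum>i\<in>I. c i * f (x - s i)) = (\<lambda>x. \<Sum>i\<in>I. c i * (bdiff h ^^ k) f (x - s i))"
  by (induction k)
     (auto simp: bdiff_def fun_eq_iff right_diff_distrib sum_subtractf algebra_simps)

text \<open>Apart from h itself, every sample point h - j h lies where f vanishes.\<close>

lemma funpow_bdiff_step:
  assumes "h > 0" "\<And>y. y \<le> 0 \<Longrightarrow> f y = 0"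
  shows "(bdiff h ^^ k) f h = f h"
proof -
  have "(\<forall>y\<le>0. (bdiff h ^^ k) f y = 0) \<and> (bdiff h ^^ k) f h = f h"
    using assms by (induction k) (auto simp: bdiff_def)
  then show ?thesis by blast
qed

text \<open>One use of the mean value theorem per difference. The induction runs over the whole
  family of derivatives: differencing commutes with differentiation, so \<open>bdiff h (F i)\<close>
  is again such a family, with left end z + h.\<close>

lemma funpow_bdiff_deriv_le:
  fixes F :: "nat \<Rightarrow> real \<Rightarrow> real"
  assumes "h > 0"
    and "\<And>i y. y > z \<Longrightarrow> (F i has_real_derivative F (Suc i) y) (at y)"
    and "x - real k * h > z"
    and "\<And>y. x - real k * h \<le> y \<Longrightarrow> y \<le> x \<Longrightarrow> \<bar>F k y\<bar> \<le> B"
  shows "\<bar>(bdiff h ^^ k) (F 0) x\<bar> \<le> h ^ k * B"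
  using assms(2-)
proof (induction k arbitrary: F z B)
  case 0
  then show ?case by simp
next
  case (Suc k)
  have "\<bar>(bdiff h ^^ k) (bdiff h (F 0)) x\<bar> \<le> h ^ k * (h * B)"
  proof (rule Suc.IH[of "z + h" "\<lambda>i. bdiff h (F i)"])
    show "(bdiff h (F i) has_real_derivative bdiff h (F (Suc i)) y) (at y)" if "y > z + h" for i y
    proof -
      have "((\<lambda>y. F i (y - h)) has_real_derivative F (Suc i) (y - h) * 1) (at y)"
        by (rule DERIV_chain2[where f = "F i", OF Suc.prems(1)]) (use that in \<open>auto intro!: derivative_eq_intros\<close>)
      from DERIV_diff[OF Suc.prems(1)[of y i] this] that assms(1) show ?thesis
        by (simp add: bdiff_def[abs_def])
    qed
    show "z + h < x - real k * h" using Suc.prems(2) by (simp add: algebra_simps)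
    fix y assume y: "x - real k * h \<le> y" "y \<le> x"
    have lo: "x - real (Suc k) * h \<le> y - h" using y by (simp add: algebra_simps)
    have "\<exists>w>y - h. w < y \<and> F k y - F k (y - h) = (y - (y - h)) * F (Suc k) w"
      by (rule MVT2) (use assms(1) lo Suc.prems(1,2) in auto)
    then obtain w where w: "w > y - h" "w < y" "F k y - F k (y - h) = h * F (Suc k) w" by auto
    have "\<bar>F (Suc k) w\<bar> \<le> B" using w(1,2) lo y by (intro Suc.prems(3)) linarith+
    then show "\<bar>bdiff h (F k) y\<bar> \<le> h * B"
      using assms(1) unfolding bdiff_def w(3) by (simp add: abs_mult)
  qed
  then show ?case unfolding funpow_bdiff_Suc by (simp add: mult_ac)
qed

text \<open>The truncated power. After multiplication by r^\<delta> the weights of a Riesz mean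
  become translates of this one function, so differences in r act on the weights alone.\<close>

definition trunc_powr :: "real \<Rightarrow> real \<Rightarrow> real" where
  "trunc_powr \<delta> y = (if y > 0 then y powr \<delta> else 0)"

text \<open>The k-th derivative is a multiple of y^(\<delta> - k), a nonincreasing power since k is
  at least \<delta>, hence largest at the leftmost sample point.\<close>

lemma funpow_bdiff_trunc_powr_le:
  assumes "h > 0" "real k \<ge> \<delta>" "x > real k * h"
  shows "\<bar>(bdiff h ^^ k) (trunc_powr \<delta>) x\<bar>
    \<le> h ^ k * (\<bar>\<Prod>j<k. \<delta> - real j\<bar> * (x - real k * h) powr (\<delta> - real k))"
proof -
  define F where "F i y = (if y > 0 then (\<Prod>j<i. \<delta> - real j) * y powr (\<delta> - real i) else 0)" for i y
  have "\<bar>(bdiff h ^^ k) (F 0) x\<bar>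
    \<le> h ^ k * (\<bar>\<Prod>j<k. \<delta> - real j\<bar> * (x - real k * h) powr (\<delta> - real k))"
  proof (rule funpow_bdiff_deriv_le[where z = 0 and F = F, OF assms(1)])
    fix i and y :: real assume y: "y > 0"
    have "((\<lambda>y. (\<Prod>j<i. \<delta> - real j) * y powr (\<delta> - real i)) has_real_derivative F (Suc i) y) (at y)"
      using DERIV_cmult[OF has_real_derivative_powr[OF y, of "\<delta> - real i"], of "\<Prod>j<i. \<delta> - real j"] y
      by (simp add: F_def algebra_simps)
    then show "(F i has_real_derivative F (Suc i) y) (at y)"
      by (rule DERIV_cong_ev[THEN iffD1, rotated -1])
         (use y in \<open>auto simp: F_def intro!: eventually_mono[OF eventually_nhds_in_open[of "{0<..}"]]\<close>)
  next
    fix y assume "x - real k * h \<le> y"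
    then have "y powr (\<delta> - real k) \<le> (x - real k * h) powr (\<delta> - real k)"
      using assms by (intro powr_mono2') auto
    then show "\<bar>F k y\<bar> \<le> \<bar>\<Prod>j<k. \<delta> - real j\<bar> * (x - real k * h) powr (\<delta> - real k)"
      by (auto simp: F_def abs_mult intro!: mult_left_mono)
  qed (use assms in auto)
  moreover have "F 0 = trunc_powr \<delta>" by (auto simp: F_def trunc_powr_def fun_eq_iff)
  ultimately show ?thesis by simp
qed

text \<open>
  A high backward difference of small step \<open>h\<close>, taken at \<open>m + h\<close>, turns \<open>r powr \<delta>\<close> times the Riesz
  mean into \<open>h powr \<delta> * t m\<close> plus a combination of the earlier terms with small total weight.
\<close>

lemma bounded_riesz_means_terms:
  fixes t :: "nat \<Rightarrow> real"
  assumes "\<delta> \<ge> 0"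
    and K: "\<And>r. r > 0 \<Longrightarrow> \<bar>\<Sum>n | real n < r. (1 - real n / r) powr \<delta> * t n\<bar> \<le> K"
  obtains C where "\<And>n. \<bar>t n\<bar> \<le> C * (real n + 1) powr \<delta>"
proof -
  \<comment> \<open>The margin 2 makes the powers with exponent \<delta> - k summable and leaves a
    spare factor h in h^k, since h^k is at most h^(\<delta> + 1).\<close>
  define k where "k = nat \<lceil>\<delta>\<rceil> + 2"
  have k: "real k \<ge> \<delta> + 2" unfolding k_def using assms(1) by linarith
  define c where "c = \<bar>\<Prod>j<k. \<delta> - real j\<bar>"
  have sz: "summable (\<lambda>l. real (Suc l) powr (\<delta> - real k))"
    using k by (subst summable_Suc_iff[of "\<lambda>l. real l powr (\<delta> - real k)"]) (simp add: summable_real_powr_iff)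
  define Z where "Z = (\<Sum>l. real (Suc l) powr (\<delta> - real k))"
  have Z0: "Z \<ge> 0" unfolding Z_def using sz by (intro suminf_nonneg) auto
  define D where "D = c * 2 powr (real k - \<delta>) * Z"
  have D0: "D \<ge> 0" using Z0 by (simp add: D_def c_def)
  \<comment> \<open>The first bound keeps all sample points within 1/2 of each other, so that l + 1
    + h - k h is at least half of l + 1. The second makes the total weight of the earlier terms at
    most half of the weight h^\<delta> of the last one.\<close>
  define h where "h = min (1 / (2 * real k)) (1 / (2 * D + 1))"
  have kpos: "k > 0" by (simp add: k_def)
  have h: "h > 0" "real k * h \<le> 1 / 2" "h * D \<le> 1 / 2"
  proof -
    show "h > 0" using kpos D0 by (simp add: h_def)
    have "h \<le> 1 / (2 * real k)" by (simp add: h_def)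
    then show "real k * h \<le> 1 / 2" using kpos by (simp add: field_simps)
    have "h \<le> 1 / (2 * D + 1)" by (simp add: h_def)
    then have "h * (2 * D + 1) \<le> 1" using D0 by (simp add: field_simps)
    then show "h * D \<le> 1 / 2" using \<open>h > 0\<close> by (simp add: algebra_simps)
  qed
  have h1: "h \<le> 1"
  proof -
    have "1 * h \<le> real k * h" using kpos h(1) by (intro mult_right_mono) auto
    then show ?thesis using h(2) by linarith
  qed
  define w where "w x = (bdiff h ^^ k) (trunc_powr \<delta>) x" for x
  have wl: "\<bar>w (h + real (Suc l))\<bar> \<le> h powr \<delta> * (h * c * 2 powr (real k - \<delta>)) * real (Suc l) powr (\<delta> - real k)" for l
  proof -
    have "\<bar>w (h + real (Suc l))\<bar> \<le> h ^ k * (c * (h + real (Suc l) - real k * h) powr (\<delta> - real k))"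
      unfolding w_def c_def by (rule funpow_bdiff_trunc_powr_le) (use h k in auto)
    also have "\<dots> \<le> h ^ k * (c * (real (Suc l) / 2) powr (\<delta> - real k))"
      using h k by (intro mult_left_mono powr_mono2') (auto simp: c_def)
    also have "\<dots> = h ^ k * (c * 2 powr (real k - \<delta>)) * real (Suc l) powr (\<delta> - real k)"
      by (simp add: powr_divide powr_diff field_simps)
    also have "\<dots> \<le> (h powr \<delta> * h) * (c * 2 powr (real k - \<delta>)) * real (Suc l) powr (\<delta> - real k)"
    proof (intro mult_right_mono)
      have "h ^ k = h powr real k" using h by (simp add: powr_realpow)
      also have "\<dots> \<le> h powr (\<delta> + 1)" using h h1 k by (intro powr_mono') auto
      finally show "h ^ k \<le> h powr \<delta> * h" using h by (simp add: powr_add)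
    qed (auto simp: c_def)
    finally show ?thesis by (simp add: mult_ac)
  qed
  have wsum: "(\<Sum>n<m. \<bar>w (h + real m - real n)\<bar>) \<le> h powr \<delta> / 2" for m
  proof -
    have "(\<Sum>n<m. \<bar>w (h + real m - real n)\<bar>) = (\<Sum>l<m. \<bar>w (h + real (Suc l))\<bar>)"
      by (subst sum.nat_diff_reindex[symmetric]) (auto intro!: sum.cong simp: of_nat_diff)
    also have "\<dots> \<le> (\<Sum>l<m. h powr \<delta> * (h * c * 2 powr (real k - \<delta>)) * real (Suc l) powr (\<delta> - real k))"
      by (intro sum_mono wl)
    also have "\<dots> = h powr \<delta> * (h * c * 2 powr (real k - \<delta>)) * (\<Sum>l<m. real (Suc l) powr (\<delta> - real k))"
      by (simp only: sum_distrib_left)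
    also have "\<dots> \<le> h powr \<delta> * (h * c * 2 powr (real k - \<delta>)) * Z"
      unfolding Z_def using sz h by (intro mult_left_mono sum_le_suminf) (auto simp: c_def)
    also have "\<dots> = h powr \<delta> * (h * D)" by (simp add: D_def)
    also have "\<dots> \<le> h powr \<delta> * (1 / 2)" using h by (intro mult_left_mono) auto
    finally show ?thesis by simp
  qed
  have whd: "w h = h powr \<delta>"
    unfolding w_def using h by (subst funpow_bdiff_step) (auto simp: trunc_powr_def)
  have K0: "K \<ge> 0" using K[of 1] by linarith
  \<comment> \<open>Only the terms up to m. For 0 < r \<le> m + h this is still r^\<delta> times the
    full Riesz mean, because h \<le> 1 lets no n beyond m satisfy n < r.\<close>
  define R where "R m r = (\<Sum>n\<le>m. t n * trunc_powr \<delta> (r - real n))" for m :: nat and r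
  have Rb: "\<bar>R m r\<bar> \<le> K * (real m + 1) powr \<delta>" if r: "r \<le> real m + h" for m r
  proof (cases "r > 0")
    case True
    have "R m r = (\<Sum>n | real n < r. t n * trunc_powr \<delta> (r - real n))"
      unfolding R_def using r h1
      by (intro sum.mono_neutral_right) (auto simp: trunc_powr_def simp flip: of_nat_le_iff)
    also have "\<dots> = (\<Sum>n | real n < r. r powr \<delta> * ((1 - real n / r) powr \<delta> * t n))"
    proof (intro sum.cong refl)
      fix n assume "n \<in> {n. real n < r}"
      then have "(r - real n) powr \<delta> = r powr \<delta> * (1 - real n / r) powr \<delta>"
        using True by (subst powr_mult[symmetric]) (auto simp: right_diff_distrib)
      then show "t n * trunc_powr \<delta> (r - real n) = r powr \<delta> * ((1 - real n / r) powr \<delta> * t n)"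
        using \<open>n \<in> _\<close> by (simp add: trunc_powr_def)
    qed
    also have "\<bar>\<dots>\<bar> \<le> r powr \<delta> * K"
      unfolding sum_distrib_left[symmetric] abs_mult using K[OF True] by (simp add: mult_left_mono)
    also have "\<dots> \<le> (real m + 1) powr \<delta> * K"
      using True r h1 assms(1) K0 by (intro mult_right_mono powr_mono2) auto
    finally show ?thesis by (simp add: mult.commute)
  next
    case False
    then have "R m r = 0" unfolding R_def by (intro sum.neutral) (auto simp: trunc_powr_def)
    then show ?thesis using K0 by simp
  qed
  \<comment> \<open>Chosen so that the difference of \<open>R\<close> accounts for half of the
    claimed bound; the earlier terms, by \<open>wsum\<close> and the induction hypothesis, account
    for the other half.\<close>
  define C where "C = 2 * (2 ^ k * K) / h powr \<delta>"
  have C0: "C \<ge> 0" using K0 by (simp add: C_def)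
  have "\<bar>t m\<bar> \<le> C * (real m + 1) powr \<delta>" for m
  proof (induction m rule: less_induct)
    case (less m)
    have "(bdiff h ^^ k) (R m) (real m + h) = (\<Sum>n\<le>m. t n * w (h + real m - real n))"
      unfolding R_def funpow_bdiff_sum by (simp add: w_def add.commute)
    also have "\<dots> = (\<Sum>n<m. t n * w (h + real m - real n)) + t m * h powr \<delta>"
      by (simp add: whd flip: lessThan_Suc_atMost)
    finally have "t m * h powr \<delta> = (bdiff h ^^ k) (R m) (real m + h) - (\<Sum>n<m. t n * w (h + real m - real n))"
      by simp
    then have "\<bar>t m * h powr \<delta>\<bar> \<le> \<bar>(bdiff h ^^ k) (R m) (real m + h)\<bar> + \<bar>\<Sum>n<m. t n * w (h + real m - real n)\<bar>"
      by simp
    also have "\<dots> \<le> 2 ^ k * (K * (real m + 1) powr \<delta>) + C * (real m + 1) powr \<delta> * (h powr \<delta> / 2)"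
    proof (intro add_mono)
      show "\<bar>(bdiff h ^^ k) (R m) (real m + h)\<bar> \<le> 2 ^ k * (K * (real m + 1) powr \<delta>)"
        using h by (intro funpow_bdiff_le Rb) auto
      have "\<bar>\<Sum>n<m. t n * w (h + real m - real n)\<bar> \<le> (\<Sum>n<m. \<bar>t n * w (h + real m - real n)\<bar>)"
        by (rule sum_abs)
      also have "\<dots> \<le> (\<Sum>n<m. C * (real m + 1) powr \<delta> * \<bar>w (h + real m - real n)\<bar>)"
        unfolding abs_mult
      proof (intro sum_mono mult_right_mono)
        fix n assume n: "n \<in> {..<m}"
        then have "\<bar>t n\<bar> \<le> C * (real n + 1) powr \<delta>" using less by simp
        also have "\<dots> \<le> C * (real m + 1) powr \<delta>"
          using n assms(1) C0 by (intro mult_left_mono powr_mono2) auto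
        finally show "\<bar>t n\<bar> \<le> C * (real m + 1) powr \<delta>" .
      qed auto
      also have "\<dots> = C * (real m + 1) powr \<delta> * (\<Sum>n<m. \<bar>w (h + real m - real n)\<bar>)"
        by (simp only: sum_distrib_left)
      also have "\<dots> \<le> C * (real m + 1) powr \<delta> * (h powr \<delta> / 2)"
        using C0 by (intro mult_left_mono wsum) auto
      finally show "\<bar>\<Sum>n<m. t n * w (h + real m - real n)\<bar> \<le> C * (real m + 1) powr \<delta> * (h powr \<delta> / 2)" .
    qed
    also have "\<dots> = C * (real m + 1) powr \<delta> * h powr \<delta>"
      unfolding C_def using h by (simp add: field_simps)
    finally show ?case using h by (simp add: abs_mult)
  qed
  then show ?thesis by (rule that)
qed

section \<open>From convergence at a point to a bound on the terms\<close>

lemma convergent_cesaro_terms: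
  assumes "\<delta> \<ge> 0" "convergent (\<lambda>N. cesaro_mean \<alpha> \<beta> \<delta> f N x)"
  obtains C where "\<And>n. n \<ge> 1 \<Longrightarrow> \<bar>jacobi_term \<alpha> \<beta> f n x\<bar> \<le> C * real n powr \<delta>"
proof -
  obtain K where "\<And>N. \<bar>cesaro_mean \<alpha> \<beta> \<delta> f N x\<bar> \<le> K"
    using assms(2) LIMSEQ_bounded_real unfolding convergent_def by blast
  then show ?thesis
    using bounded_cesaro_means_terms[OF assms(1), of "\<lambda>n. jacobi_term \<alpha> \<beta> f n x" K] that
    by (auto simp: cesaro_mean_def)
qed

lemma convergent_riesz_terms:
  assumes "\<delta> \<ge> 0" "((\<lambda>r. riesz_mean \<alpha> \<beta> \<delta> f r x) \<longlongrightarrow> L) at_top"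
  obtains C where "\<And>n. n \<ge> 1 \<Longrightarrow> \<bar>jacobi_term \<alpha> \<beta> f n x\<bar> \<le> C * real n powr \<delta>"
proof -
  let ?t = "\<lambda>n. jacobi_term \<alpha> \<beta> f n x"
  have "eventually (\<lambda>r. \<bar>riesz_mean \<alpha> \<beta> \<delta> f r x - L\<bar> < 1) at_top"
    using tendstoD[OF assms(2), of 1] by (simp add: dist_real_def)
  then obtain r0 where r0: "\<And>r. r \<ge> r0 \<Longrightarrow> \<bar>riesz_mean \<alpha> \<beta> \<delta> f r x - L\<bar> < 1"
    by (auto simp: eventually_at_top_linorder)
  have fin: "finite {n. real n < r}" for r
    by (rule finite_subset[of _ "{..nat \<lceil>r\<rceil>}"]) (auto, linarith)
  \<comment> \<open>Convergence bounds the means only from \<open>r0\<close> on. For smaller r the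
    weights are at most 1, and the finitely many terms below \<open>r0\<close> give a bound.\<close>
  define T where "T = (\<Sum>n | real n < r0. \<bar>?t n\<bar>)"
  have "\<bar>\<Sum>n | real n < r. (1 - real n / r) powr \<delta> * ?t n\<bar> \<le> T + (\<bar>L\<bar> + 1)" if "r > 0" for r
  proof (cases "r \<ge> r0")
    case True
    have "T \<ge> 0" by (auto simp: T_def intro: sum_nonneg)
    then show ?thesis using r0[OF True] unfolding riesz_mean_def by linarith
  next
    case False
    have "\<bar>\<Sum>n | real n < r. (1 - real n / r) powr \<delta> * ?t n\<bar> \<le> (\<Sum>n | real n < r. \<bar>?t n\<bar>)"
    proof (rule order_trans[OF sum_abs sum_mono])
      fix n assume "n \<in> {n. real n < r}"
      then have "(1 - real n / r) powr \<delta> \<le> 1"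
        using that assms(1) by (intro powr_le1) (auto simp: field_simps)
      then show "\<bar>(1 - real n / r) powr \<delta> * ?t n\<bar> \<le> \<bar>?t n\<bar>"
        by (simp add: abs_mult mult_left_le_one_le)
    qed
    also have "\<dots> \<le> T" unfolding T_def using False fin by (intro sum_mono2) auto
    finally show ?thesis by linarith
  qed
  from bounded_riesz_means_terms[OF assms(1) this]
  obtain C where C: "\<And>n. \<bar>?t n\<bar> \<le> C * (real n + 1) powr \<delta>" by blast
  have C0: "C \<ge> 0" using C[of 0] by simp
  show ?thesis
  proof (rule that[of "C * 2 powr \<delta>"])
    fix n :: nat assume n: "n \<ge> 1"
    have "(real n + 1) powr \<delta> \<le> (2 * real n) powr \<delta>"
      using n assms(1) by (intro powr_mono2) auto
    then show "\<bar>?t n\<bar> \<le> C * 2 powr \<delta> * real n powr \<delta>"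
      using order_trans[OF C[of n] mult_left_mono[OF _ C0]] by (simp add: powr_mult mult.assoc)
  qed
qed

subsection \<open>Integrals of Jacobi polynomials\<close>

lemma alternating_binomial_sum_Suc:
  fixes f :: "nat \<Rightarrow> real"
  shows "(\<Sum>j\<le>Suc n. (-1) ^ j * real (Suc n choose j) * f j)
    = (\<Sum>j\<le>n. (-1) ^ j * real (n choose j) * f j) - (\<Sum>j\<le>n. (-1) ^ j * real (n choose j) * f (Suc j))"
proof -
  have "(\<Sum>j\<le>Suc n. (-1) ^ j * real (Suc n choose j) * f j)
      = f 0 + (\<Sum>j\<le>n. (-1) ^ Suc j * real (n choose Suc j) * f (Suc j))
        + (\<Sum>j\<le>n. (-1) ^ Suc j * real (n choose j) * f (Suc j))"
    by (subst sum.atMost_Suc_shift) (simp add: ring_distribs sum_subtractf sum_negf)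
  also have "f 0 + (\<Sum>j\<le>n. (-1) ^ Suc j * real (n choose Suc j) * f (Suc j))
      = (\<Sum>j\<le>Suc n. (-1) ^ j * real (n choose j) * f j)"
    by (subst sum.atMost_Suc_shift) simp
  finally show ?thesis by (simp add: sum_negf)
qed

text \<open>A form of the Chu-Vandermonde identity. Pascal's rule leaves the sums for a and for a +
  1, and their difference produces the factor (a + n) - (a + s) = n - s, which is the next factor of
  the Pochhammer symbol.\<close>

lemma alternating_sum_Gamma:
  fixes a s :: real
  assumes "a > 0" "a + s > 0"
  shows "(\<Sum>j\<le>n. (-1) ^ j * real (n choose j) * (Gamma (a + real j + s) / Gamma (a + real j)))
    = pochhammer (- s) n * Gamma (a + s) / Gamma (a + real n)"
  using assms
proof (induction n arbitrary: a)
  case 0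
  then show ?case by simp
next
  case (Suc n)
  let ?f = "\<lambda>j. Gamma (a + real j + s) / Gamma (a + real j)"
  have "(\<Sum>j\<le>Suc n. (-1) ^ j * real (Suc n choose j) * ?f j)
      = (\<Sum>j\<le>n. (-1) ^ j * real (n choose j) * ?f j) - (\<Sum>j\<le>n. (-1) ^ j * real (n choose j) * ?f (Suc j))"
    by (rule alternating_binomial_sum_Suc)
  also have "(\<Sum>j\<le>n. (-1) ^ j * real (n choose j) * ?f j)
      = pochhammer (- s) n * Gamma (a + s) / Gamma (a + real n)"
    by (rule Suc.IH[OF Suc.prems])
  also have "(\<Sum>j\<le>n. (-1) ^ j * real (n choose j) * ?f (Suc j))
      = (\<Sum>j\<le>n. (-1) ^ j * real (n choose j) * (Gamma ((a + 1) + real j + s) / Gamma ((a + 1) + real j)))"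
    by (simp add: add_ac)
  also have "\<dots> = pochhammer (- s) n * Gamma (a + 1 + s) / Gamma (a + 1 + real n)"
    using Suc.prems by (subst Suc.IH) auto
  also have "Gamma (a + 1 + s) = (a + s) * Gamma (a + s)"
    using Gamma_plus1[OF pos_not_nonpos_Int[OF Suc.prems(2)]] by (simp add: add_ac)
  also have "Gamma (a + 1 + real n) = (a + real n) * Gamma (a + real n)"
    using Gamma_plus1[OF pos_not_nonpos_Int, of "a + real n"] Suc.prems by (simp add: add_ac)
  also have "pochhammer (- s) n * Gamma (a + s) / Gamma (a + real n)
      - pochhammer (- s) n * ((a + s) * Gamma (a + s)) / ((a + real n) * Gamma (a + real n))
      = pochhammer (- s) (Suc n) * Gamma (a + s) / ((a + real n) * Gamma (a + real n))"
  proof -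
    have pos: "Gamma (a + real n) > 0" "a + real n > 0"
      using Suc.prems by (auto intro!: Gamma_real_pos)
    have "X / G - X * S / (N * G) = X * (N - S) / (N * G)" if "G > 0" "N > 0" for X N S G :: real
      using that by (simp add: divide_simps algebra_simps)
    from this[OF pos, of "pochhammer (- s) n * Gamma (a + s)" "a + s"] show ?thesis
      by (simp add: pochhammer_Suc mult_ac)
  qed
  also have "(a + real n) * Gamma (a + real n) = Gamma (a + real (Suc n))"
    using Gamma_plus1[OF pos_not_nonpos_Int, of "a + real n"] Suc.prems by (simp add: add_ac)
  finally show ?case .
qed

lemma jacobi_measure_shift:
  assumes "f \<in> borel_measurable borel"
  shows "has_bochner_integral (jacobi_measure (\<alpha> + s) \<beta>) f v \<longleftrightarrow>
    has_bochner_integral (jacobi_measure \<alpha> \<beta>) (\<lambda>x. (1 - x) powr s * f x) v"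
proof -
  have "(\<lambda>x. (1 - x) powr s * f x) \<in> borel_measurable borel" using assms by measurable
  then show ?thesis
    by (simp add: has_bochner_integral_iff jacobi_measure_integral_mult assms powr_add mult_ac)
qed

lemma borel_measurable_poly [measurable]: "poly (q :: real poly) \<in> borel_measurable borel"
  by (intro borel_measurable_continuous_onI continuous_intros)

text \<open>The power is absorbed into the weight, whereupon each summand of the polynomial is a
  Beta integral. The formula serves twice: s = n yields the norm, and s = - \<gamma> the
  coefficients of the singular function.\<close>

lemma jacobi_poly_powr_integral:
  fixes \<alpha> \<beta> s :: real
  assumes ab: "\<alpha> > -1" "\<beta> > -1" and s: "\<alpha> + s > -1"
  shows "has_bochner_integral (jacobi_measure \<alpha> \<beta>)
    (\<lambda>x. (1 - x) powr s * poly (jacobi_poly \<alpha> \<beta> n) x)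
    (2 powr (\<alpha> + \<beta> + s + 1) * Gamma (\<alpha> + s + 1) * pochhammer (- s) n
      * Gamma (real n + \<beta> + 1) / (fact n * Gamma (\<alpha> + \<beta> + s + real n + 2)))"
proof -
  let ?c = "\<lambda>j. ((real n + \<alpha>) gchoose (n - j)) * ((real n + \<beta>) gchoose j) * (-1) ^ j / 2 ^ n"
  let ?v = "\<lambda>j. 2 powr (\<alpha> + s + \<beta> + real j + real (n - j) + 1)
    * Beta (\<alpha> + s + real j + 1) (\<beta> + real (n - j) + 1)"
  have fn: "poly (jacobi_poly \<alpha> \<beta> n) x = (\<Sum>j\<le>n. ?c j * ((1 - x) ^ j * (1 + x) ^ (n - j)))" for x
    unfolding poly_jacobi_poly
  proof (intro sum.cong refl)
    fix j assume "j \<in> {..n}"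
    then have 1: "(2::real) ^ n = 2 ^ j * 2 ^ (n - j)" by (simp flip: power_add)
    have 2: "((x - 1) / 2) ^ j = (-1) ^ j * (1 - x) ^ j / 2 ^ j"
      by (simp add: power_divide flip: power_mult_distrib)
    show "((real n + \<alpha>) gchoose (n - j)) * ((real n + \<beta>) gchoose j)
       * ((x - 1) / 2) ^ j * ((x + 1) / 2) ^ (n - j)
       = ?c j * ((1 - x) ^ j * (1 + x) ^ (n - j))"
      unfolding 1 2 by (simp add: power_divide add.commute)
  qed
  have I: "has_bochner_integral (jacobi_measure (\<alpha> + s) \<beta>)
    (\<lambda>x. \<Sum>j\<le>n. ?c j * ((1 - x) ^ j * (1 + x) ^ (n - j))) (\<Sum>j\<le>n. ?c j * ?v j)"
    by (intro has_bochner_integral_sum has_bochner_integral_mult_right jacobi_monomial_integral ab s)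
  define C where "C = 2 powr (\<alpha> + \<beta> + s + real n + 1) / 2 ^ n
    * (Gamma (real n + \<alpha> + 1) * Gamma (real n + \<beta> + 1) / (fact n * Gamma (\<alpha> + \<beta> + s + real n + 2)))"
  have "?c j * ?v j = C * ((-1) ^ j * real (n choose j)
      * (Gamma ((\<alpha> + 1) + real j + s) / Gamma ((\<alpha> + 1) + real j)))"
    if "j \<le> n" for j
  proof -
    have pos: "(\<alpha> + 1) + real j > 0" "\<beta> + real (n - j) + 1 > 0" using ab by linarith+
    have np: "real n + \<alpha> + 1 \<notin> \<int>\<^sub>\<le>\<^sub>0" "real n + \<beta> + 1 \<notin> \<int>\<^sub>\<le>\<^sub>0"
      using ab by (intro pos_not_nonpos_Int; simp)+
    have g1: "((real n + \<alpha>) gchoose (n - j)) = Gamma (real n + \<alpha> + 1) / (fact (n - j) * Gamma ((\<alpha> + 1) + real j))"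
      using gbinomial_Gamma[of "real n + \<alpha>" "n - j"] np that by (simp add: of_nat_diff algebra_simps)
    have g2: "((real n + \<beta>) gchoose j) = Gamma (real n + \<beta> + 1) / (fact j * Gamma (\<beta> + real (n - j) + 1))"
      using gbinomial_Gamma[of "real n + \<beta>" j] np that by (simp add: of_nat_diff algebra_simps)
    have g4: "real (n choose j) = fact n / (fact j * fact (n - j))"
      using binomial_fact[OF that, where 'a = real] .
    have g5: "\<alpha> + s + \<beta> + real j + real (n - j) + 1 = \<alpha> + \<beta> + s + real n + 1"
      "\<alpha> + s + real j + 1 + (\<beta> + real (n - j) + 1) = \<alpha> + \<beta> + s + real n + 2"
      "\<alpha> + s + real j + 1 = (\<alpha> + 1) + real j + s"
      using that by (auto simp: of_nat_diff)
    show ?thesis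
      unfolding Beta_def g5(1,2) unfolding g5(3) g1 g2 g4 C_def
      using Gamma_real_pos[OF pos(1)] Gamma_real_pos[OF pos(2)] by (simp add: field_simps)
  qed
  then have "(\<Sum>j\<le>n. ?c j * ?v j) = C * (\<Sum>j\<le>n. (-1) ^ j * real (n choose j)
      * (Gamma ((\<alpha> + 1) + real j + s) / Gamma ((\<alpha> + 1) + real j)))"
    unfolding sum_distrib_left by (intro sum.cong) auto
  also have "\<dots> = C * (pochhammer (- s) n * Gamma (\<alpha> + 1 + s) / Gamma (\<alpha> + 1 + real n))"
    using ab s by (subst alternating_sum_Gamma) auto
  also have "\<dots> = 2 powr (\<alpha> + \<beta> + s + 1) * Gamma (\<alpha> + s + 1) * pochhammer (- s) n
      * Gamma (real n + \<beta> + 1) / (fact n * Gamma (\<alpha> + \<beta> + s + real n + 2))"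
  proof -
    have "Gamma (\<alpha> + 1 + real n) > 0" using ab by (intro Gamma_real_pos) simp
    moreover have "2 powr (\<alpha> + \<beta> + s + real n + 1) = 2 powr (\<alpha> + \<beta> + s + 1) * (2::real) ^ n"
      by (simp add: powr_add powr_realpow)
    ultimately show ?thesis unfolding C_def by (simp add: add_ac)
  qed
  finally have v: "(\<Sum>j\<le>n. ?c j * ?v j) = \<dots>" .
  have "has_bochner_integral (jacobi_measure (\<alpha> + s) \<beta>) (poly (jacobi_poly \<alpha> \<beta> n)) (\<Sum>j\<le>n. ?c j * ?v j)"
    using I unfolding fn[symmetric] .
  then show ?thesis
    unfolding v by (subst (asm) jacobi_measure_shift) auto
qed

section \<open>Leading coefficient and norm\<close>

lemma coeff_jacobi_poly:
  assumes "\<alpha> + \<beta> > -1"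
  shows "coeff (jacobi_poly \<alpha> \<beta> n) n
    = Gamma (2 * real n + \<alpha> + \<beta> + 1) / (2 ^ n * fact n * Gamma (real n + \<alpha> + \<beta> + 1))"
proof -
  let ?q = "\<lambda>s. [:- 1 / 2, 1 / 2:] ^ s * [:1 / 2, 1 / 2:] ^ (n - s) :: real poly"
  have lc: "coeff (?q s) n = (1 / 2) ^ n" if "s \<le> n" for s
  proof -
    have "degree (?q s) = n" using that by (simp add: degree_mult_eq degree_power_eq)
    then have "coeff (?q s) n = lead_coeff (?q s)" by simp
    also have "\<dots> = (1 / 2) ^ s * (1 / 2) ^ (n - s)"
      unfolding lead_coeff_mult lead_coeff_power by simp
    also have "\<dots> = (1 / 2) ^ n" using that by (simp flip: power_add)
    finally show ?thesis .
  qed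
  have "coeff (jacobi_poly \<alpha> \<beta> n) n =
    (\<Sum>s\<le>n. ((real n + \<alpha>) gchoose (n - s)) * ((real n + \<beta>) gchoose s) * (1 / 2) ^ n)"
    unfolding jacobi_poly_def coeff_sum coeff_smult
    by (intro sum.cong refl) (simp only: lc atMost_iff)
  also have "\<dots> = (\<Sum>s = 0..n. ((real n + \<beta>) gchoose s) * ((real n + \<alpha>) gchoose (n - s))) * (1 / 2) ^ n"
    by (simp add: sum_distrib_left sum_distrib_right atMost_atLeast0 mult_ac)
  also have "\<dots> = ((2 * real n + \<alpha> + \<beta>) gchoose n) * (1 / 2) ^ n"
    unfolding gbinomial_Vandermonde by (simp add: algebra_simps)
  also have "(2 * real n + \<alpha> + \<beta>) gchoose n
      = Gamma (2 * real n + \<alpha> + \<beta> + 1) / (fact n * Gamma (2 * real n + \<alpha> + \<beta> - real n + 1))"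
    using assms by (intro gbinomial_Gamma pos_not_nonpos_Int) simp
  finally show ?thesis by (simp add: power_divide algebra_simps)
qed

lemma jacobi_measure_poly_integrable:
  fixes \<alpha> \<beta> :: real
  assumes "\<alpha> > -1" "\<beta> > -1"
  shows "integrable (jacobi_measure \<alpha> \<beta>) (poly q)"
proof -
  define r where "r = pcompose q [:1, -1:]"
  have "poly q = (\<lambda>x. \<Sum>k\<le>degree r. coeff r k * ((1 - x) ^ k * (1 + x) ^ 0))"
    using poly_altdef[of r "1 - x" for x] by (simp add: fun_eq_iff r_def poly_pcompose)
  moreover have "integrable (jacobi_measure \<alpha> \<beta>) (\<lambda>x. \<Sum>k\<le>degree r. coeff r k * ((1 - x) ^ k * (1 + x) ^ 0))"
    by (intro Bochner_Integration.integrable_sum integrable_mult_right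
          integrable.intros[OF jacobi_monomial_integral] assms)
  ultimately show ?thesis by (simp only:)
qed

lemma jacobi_norm_sq_eq_poly:
  "jacobi_norm_sq \<alpha> \<beta> n = (LINT x|jacobi_measure \<alpha> \<beta>. poly ((jacobi_poly \<alpha> \<beta> n)\<^sup>2) x)"
  by (simp add: jacobi_norm_sq_def)

text \<open>By orthogonality one factor P may be replaced by the multiple of (1 - x)^n with the same
  leading coefficient; the remaining integral is explicit.\<close>

lemma jacobi_norm_sq_eq:
  fixes \<alpha> \<beta> :: real
  assumes ab: "\<alpha> > -1" "\<beta> > -1" and sum: "\<alpha> + \<beta> > -1"
  shows "jacobi_norm_sq \<alpha> \<beta> n = 2 powr (\<alpha> + \<beta> + 1) * Gamma (real n + \<alpha> + 1) * Gamma (real n + \<beta> + 1)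
    / ((2 * real n + \<alpha> + \<beta> + 1) * fact n * Gamma (real n + \<alpha> + \<beta> + 1))"
proof -
  let ?P = "jacobi_poly \<alpha> \<beta> n" and ?M = "jacobi_measure \<alpha> \<beta>"
  define l where "l = (-1) ^ n * coeff ?P n"
  define q where "q = ?P - smult l ([:1, -1:] ^ n)"
  have cn: "coeff ([:1, -1:] ^ n) n = (-1::real) ^ n"
    using lead_coeff_power[of "[:1, -1::real:]" n] by (simp add: degree_power_eq)
  have dn: "degree ([:1, -1::real:] ^ n) = n" by (simp add: degree_power_eq)
  have "degree q \<le> n"
    unfolding q_def using dn degree_jacobi_poly[OF ab, of n]
    by (intro degree_diff_le) (auto intro: order_trans[OF degree_smult_le])
  moreover have "coeff q n = 0" by (simp add: q_def cn l_def flip: power_add)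
  \<comment> \<open>The second case is for n = 0, where no degree is smaller than n.\<close>
  ultimately have q: "degree q < n \<or> q = 0"
    by (metis leading_coeff_0_iff le_neq_implies_less)
  have 1: "has_bochner_integral ?M (\<lambda>x. poly ?P x * poly q x) 0"
    using q jacobi_poly_orthogonal[OF ab] by auto
  have "has_bochner_integral ?M (\<lambda>x. (1 - x) powr real n * poly ?P x)
    (2 powr (\<alpha> + \<beta> + real n + 1) * Gamma (\<alpha> + real n + 1) * pochhammer (- real n) n
      * Gamma (real n + \<beta> + 1) / (fact n * Gamma (\<alpha> + \<beta> + real n + real n + 2)))" (is "has_bochner_integral _ _ ?I")
    using ab by (intro jacobi_poly_powr_integral) auto
  then have 2: "has_bochner_integral ?M (\<lambda>x. l * ((1 - x) powr real n * poly ?P x)) (l * ?I)"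
    by (rule has_bochner_integral_mult_right)
  have 3: "has_bochner_integral ?M (\<lambda>x. poly ?P x * poly q x + l * ((1 - x) powr real n * poly ?P x)) (0 + l * ?I)"
    by (rule has_bochner_integral_add[OF 1 2])
  have "jacobi_norm_sq \<alpha> \<beta> n = (LINT x|?M. poly ?P x * poly q x + l * ((1 - x) powr real n * poly ?P x))"
    unfolding jacobi_norm_sq_def
  proof (intro integral_cong_AE)
    \<comment> \<open>The point 1 is left out because of n = 0: there \<open>0 powr 0\<close> is 0,
      whereas the power with natural exponent is 1.\<close>
    have "AE x in lborel. x \<noteq> (1::real)" by (rule AE_lborel_singleton)
    then have "AE x in lborel. x \<in> {-1..1} \<longrightarrow> \<bar>poly ?P x\<bar>\<^sup>2 = poly ?P x * poly q x + l * ((1 - x) powr real n * poly ?P x)"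
    proof eventually_elim
      case (elim x)
      show ?case
      proof
        assume "x \<in> {-1..1}"
        then have "(1 - x) powr real n = (1 - x) ^ n" using elim by (simp add: powr_realpow)
        moreover have "poly ?P x = poly q x + l * (1 - x) ^ n" by (simp add: q_def)
        ultimately show "\<bar>poly ?P x\<bar>\<^sup>2 = poly ?P x * poly q x + l * ((1 - x) powr real n * poly ?P x)"
          by (simp add: power2_eq_square algebra_simps)
      qed
    qed
    then have "AE x in restrict_space lborel {-1..1}. \<bar>poly ?P x\<bar>\<^sup>2 = poly ?P x * poly q x + l * ((1 - x) powr real n * poly ?P x)"
      by (subst AE_restrict_space_iff) auto
    then show "AE x in ?M. \<bar>poly ?P x\<bar>\<^sup>2 = poly ?P x * poly q x + l * ((1 - x) powr real n * poly ?P x)"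
      unfolding jacobi_measure_def
      by (subst AE_density) (auto intro!: measurable_restrict_space1)
  qed (auto simp: jacobi_measure_def intro!: measurable_restrict_space1)
  also have "\<dots> = l * ?I" using has_bochner_integral_integral_eq[OF 3] by simp
  also have "\<dots> = 2 powr (\<alpha> + \<beta> + 1) * Gamma (real n + \<alpha> + 1) * Gamma (real n + \<beta> + 1)
    / ((2 * real n + \<alpha> + \<beta> + 1) * fact n * Gamma (real n + \<alpha> + \<beta> + 1))"
  proof -
    have p: "pochhammer (- real n) n = (-1) ^ n * fact n"
      using pochhammer_minus[of "real n" n] by (simp add: pochhammer_fact)
    have w: "2 powr (\<alpha> + \<beta> + real n + 1) = 2 powr (\<alpha> + \<beta> + 1) * (2::real) ^ n"
      by (simp add: powr_add powr_realpow)
    have pos: "2 * real n + \<alpha> + \<beta> + 1 > 0" using sum by simp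
    have G: "Gamma (\<alpha> + \<beta> + real n + real n + 2)
        = (2 * real n + \<alpha> + \<beta> + 1) * Gamma (2 * real n + \<alpha> + \<beta> + 1)"
      using Gamma_plus1[OF pos_not_nonpos_Int[OF pos]] by (simp add: algebra_simps)
    have "Gamma (2 * real n + \<alpha> + \<beta> + 1) > 0" using pos by (rule Gamma_real_pos)
    then show ?thesis
      unfolding l_def coeff_jacobi_poly[OF sum] p w G by (simp add: add_ac mult_ac flip: power_add)
  qed
  finally show ?thesis .
qed

subsection \<open>The differential equation\<close>

lemma pderiv_sum: "pderiv (sum f I) = (\<Sum>i\<in>I. pderiv (f i))"
  using higher_pderiv_sum[of 1 f I] by simp

text \<open>Times the weight, the integrand is the derivative of (1 - x)^(\<alpha> + 1) (1 +
  x)^(\<beta> + 1) q(x), which vanishes at both endpoints. On powers of 1 - x this amounts to the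
  recurrence of Gamma, and that is how it is proved.\<close>

lemma jacobi_integration_by_parts:
  fixes \<alpha> \<beta> :: real
  assumes ab: "\<alpha> > -1" "\<beta> > -1"
  shows "has_bochner_integral (jacobi_measure \<alpha> \<beta>)
    (poly ([:1, 0, -1:] * pderiv q + [:\<beta> - \<alpha>, - (\<alpha> + \<beta> + 2):] * q)) 0"
proof -
  let ?M = "jacobi_measure \<alpha> \<beta>"
  define r where "r = pcompose q [:1, -1:]"
  define T where "T k x = (\<beta> + 1) * ((1 - x) ^ Suc k * (1 + x) ^ 0)
    - (\<alpha> + 1 + real k) * ((1 - x) ^ k * (1 + x) ^ 1)" for k :: nat and x :: real
  have "has_bochner_integral ?M (T k) 0" for k
  proof -
    have "has_bochner_integral ?M (T k)
      ((\<beta> + 1) * (2 powr (\<alpha> + \<beta> + real (Suc k) + real 0 + 1) * Beta (\<alpha> + real (Suc k) + 1) (\<beta> + real 0 + 1))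
      - (\<alpha> + 1 + real k) * (2 powr (\<alpha> + \<beta> + real k + real 1 + 1) * Beta (\<alpha> + real k + 1) (\<beta> + real 1 + 1)))"
      unfolding T_def
      by (intro has_bochner_integral_diff has_bochner_integral_mult_right jacobi_monomial_integral ab)
    moreover have "Gamma (\<alpha> + real (Suc k) + 1) = (\<alpha> + 1 + real k) * Gamma (\<alpha> + real k + 1)"
      using Gamma_plus1[OF pos_not_nonpos_Int, of "\<alpha> + real k + 1"] ab by (simp add: add_ac)
    moreover have "Gamma (\<beta> + real 1 + 1) = (\<beta> + 1) * Gamma (\<beta> + real 0 + 1)"
      using Gamma_plus1[OF pos_not_nonpos_Int, of "\<beta> + 1"] ab by (simp add: add_ac)
    ultimately show ?thesis by (simp add: Beta_def add_ac)
  qed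
  then have "has_bochner_integral ?M (\<lambda>x. \<Sum>k\<le>degree r. coeff r k * T k x) (\<Sum>k\<le>degree r. coeff r k * 0)"
    by (intro has_bochner_integral_sum has_bochner_integral_mult_right)
  moreover have "(\<lambda>x. \<Sum>k\<le>degree r. coeff r k * T k x)
    = poly ([:1, 0, -1:] * pderiv q + [:\<beta> - \<alpha>, - (\<alpha> + \<beta> + 2):] * q)"
  proof
    fix x
    \<comment> \<open>The operator in the variable y = 1 - x: here 1 - x^2 is 2 y - y^2, and the
      derivative changes sign.\<close>
    have mon: "T k x * c = poly ([:0, -2, 1:] * pderiv (monom c k) + [:- 2 * (\<alpha> + 1), \<alpha> + \<beta> + 2:] * monom c k) (1 - x)"
      for k c
      by (cases k) (simp_all add: T_def pderiv_monom poly_monom algebra_simps)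
    have "(\<Sum>k\<le>degree r. coeff r k * T k x)
      = poly ([:0, -2, 1:] * pderiv (\<Sum>k\<le>degree r. monom (coeff r k) k)
          + [:- 2 * (\<alpha> + 1), \<alpha> + \<beta> + 2:] * (\<Sum>k\<le>degree r. monom (coeff r k) k)) (1 - x)"
      unfolding pderiv_sum sum_distrib_left sum.distrib[symmetric] poly_sum mon[symmetric]
      by (simp only: mult.commute)
    also have "(\<Sum>k\<le>degree r. monom (coeff r k) k) = r" by (rule poly_as_sum_of_monoms)
    also have "pderiv r = - pcompose (pderiv q) [:1, -1:]"
      by (simp add: r_def pderiv_pcompose pderiv_pCons)
    finally show "(\<Sum>k\<le>degree r. coeff r k * T k x)
      = poly ([:1, 0, -1:] * pderiv q + [:\<beta> - \<alpha>, - (\<alpha> + \<beta> + 2):] * q) x"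
      by (simp add: r_def poly_pcompose algebra_simps power2_eq_square)
  qed
  ultimately show ?thesis by (simp only: mult_zero_right sum.neutral_const)
qed

text \<open>On products of powers of (x - 1)/2 and (x + 1)/2 of fixed total degree the Jacobi
  operator is tridiagonal, so the differential equation becomes a relation between neighbouring
  coefficients. Truncated subtraction in the exponents is harmless: those summands carry the factor
  s or m.\<close>

lemma poly_diff_operator_product:
  fixes \<alpha> \<beta> x :: real and s m :: nat
  defines "e \<equiv> [:- 1 / 2, 1 / 2:] ^ s * [:1 / 2, 1 / 2:] ^ m"
    and "y \<equiv> (x - 1) / 2" and "z \<equiv> (x + 1) / 2"
  shows "poly ([:1, 0, -1:] * pderiv (pderiv e) + [:\<beta> - \<alpha>, - (\<alpha> + \<beta> + 2):] * pderiv e) x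
    = - (real s * (real s + \<alpha>) * y ^ (s - 1) * z ^ Suc m)
      - (2 * real s * real m + (\<beta> + 1) * real s + (\<alpha> + 1) * real m) * y ^ s * z ^ m
      - real m * (real m + \<beta>) * y ^ Suc s * z ^ (m - 1)"
proof -
  define Y Z where "Y = [:- 1 / 2, 1 / 2 :: real:]" and "Z = [:1 / 2, 1 / 2 :: real:]"
  have YZ: "poly Y x = y" "poly Z x = z"
    by (simp_all add: Y_def Z_def y_def z_def field_simps)
  have dY: "pderiv (Y ^ i) = smult (real i / 2) (Y ^ (i - 1))"
    and dZ: "pderiv (Z ^ i) = smult (real i / 2) (Z ^ (i - 1))" for i
    by (simp_all add: pderiv_power Y_def Z_def pderiv_pCons)
  have e: "e = Y ^ s * Z ^ m" by (simp only: e_def Y_def Z_def)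
  have A: "poly [:1, 0, -1:] x = - 4 * y * z" and B: "poly [:\<beta> - \<alpha>, - (\<alpha> + \<beta> + 2):] x = - 2 * (\<beta> + 1) * y - 2 * (\<alpha> + 1) * z"
    by (simp_all add: y_def z_def field_simps)
  define a0 a1 a2 where "a0 = y ^ s" and "a1 = real s * y ^ (s - 1)" and "a2 = real s * (real (s - 1) * y ^ (s - 1 - 1))"
  define b0 b1 b2 where "b0 = z ^ m" and "b1 = real m * z ^ (m - 1)" and "b2 = real m * (real (m - 1) * z ^ (m - 1 - 1))"
  have ya: "y * a1 = real s * a0" "y * a2 = (real s - 1) * a1"
    unfolding a0_def a1_def a2_def by (cases s; simp; cases "s - 1"; simp)+
  have zb: "z * b1 = real m * b0" "z * b2 = (real m - 1) * b1"
    unfolding b0_def b1_def b2_def by (cases m; simp; cases "m - 1"; simp)+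
  have e1: "poly (pderiv e) x = (a1 * b0 + a0 * b1) / 2"
    by (simp add: e pderiv_mult dY dZ YZ a0_def a1_def b0_def b1_def del: poly_pCons)
  have e2: "poly (pderiv (pderiv e)) x = (a2 * b0 + 2 * a1 * b1 + a0 * b2) / 4"
    by (simp add: e pderiv_mult pderiv_add pderiv_smult dY dZ YZ a0_def a1_def a2_def b0_def b1_def b2_def
        algebra_simps del: poly_pCons)
  have "poly ([:1, 0, -1:] * pderiv (pderiv e) + [:\<beta> - \<alpha>, - (\<alpha> + \<beta> + 2):] * pderiv e) x
    = - ((y * a2) * (z * b0) + 2 * (y * a1) * (z * b1) + (y * a0) * (z * b2))
      - (\<beta> + 1) * ((y * a1) * b0 + y * a0 * b1) - (\<alpha> + 1) * (z * a1 * b0 + a0 * (z * b1))"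
    unfolding poly_add poly_mult A B e1 e2 by (simp add: field_simps)
  also have "\<dots> = - ((real s + \<alpha>) * a1 * (z * b0))
      - (2 * real s * real m + (\<beta> + 1) * real s + (\<alpha> + 1) * real m) * a0 * b0
      - (real m + \<beta>) * (y * a0) * b1"
    unfolding ya zb by (simp add: algebra_simps)
  finally show ?thesis by (simp add: a0_def a1_def b0_def b1_def mult_ac)
qed

text \<open>In this basis the equation is a balance of exchanges between the neighbours s and s + 1.
  The two rates of each exchange agree by \<open>wv\<close>, the recurrence of the binomial
  coefficients, so everything cancels.\<close>

lemma jacobi_poly_ode:
  fixes \<alpha> \<beta> :: real and n :: nat
  defines "P \<equiv> jacobi_poly \<alpha> \<beta> n"
  shows "[:1, 0, -1:] * pderiv (pderiv P) + [:\<beta> - \<alpha>, - (\<alpha> + \<beta> + 2):] * pderiv P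
    = smult (- (real n * (real n + \<alpha> + \<beta> + 1))) P"
proof (rule poly_ext)
  fix x :: real
  define y where "y = (x - 1) / 2"
  define z where "z = (x + 1) / 2"
  define c where "c s = ((real n + \<alpha>) gchoose (n - s)) * ((real n + \<beta>) gchoose s)" for s
  define E where "E s = y ^ s * z ^ (n - s)" for s
  define w where "w s = real s * (real s + \<alpha>) * c s" for s
  define v where "v s = real (n - s) * (real (n - s) + \<beta>) * c s" for s
  have wv: "w (Suc s) = v s" if "s < n" for s
  proof -
    obtain m where m: "n = Suc (s + m)" using \<open>s < n\<close> less_imp_Suc_add by blast
    have 1: "n - s = Suc m" "n - Suc s = m" using m by auto
    have 2: "real (Suc s) * ((real n + \<beta>) gchoose Suc s) = (real (Suc m) + \<beta>) * ((real n + \<beta>) gchoose s)"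
      using gbinomial_mult_1[of "real n + \<beta>" s] m by (simp add: algebra_simps)
    have 3: "(real (Suc s) + \<alpha>) * ((real n + \<alpha>) gchoose m) = real (Suc m) * ((real n + \<alpha>) gchoose Suc m)"
      using gbinomial_mult_1[of "real n + \<alpha>" m] m by (simp add: algebra_simps)
    have "w (Suc s) = ((real (Suc s) + \<alpha>) * ((real n + \<alpha>) gchoose m)) * (real (Suc s) * ((real n + \<beta>) gchoose Suc s))"
      unfolding w_def c_def 1 by (simp only: mult_ac)
    also have "\<dots> = v s" unfolding v_def c_def 1 2 3 by (simp only: mult_ac)
    finally show ?thesis .
  qed
  let ?L = "\<lambda>p. [:1, 0, -1:] * pderiv (pderiv p) + [:\<beta> - \<alpha>, - (\<alpha> + \<beta> + 2):] * pderiv p"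
  define e where "e s = [:- 1 / 2, 1 / 2:] ^ s * [:1 / 2, 1 / 2 :: real:] ^ (n - s)" for s
  let ?lam = "real n * (real n + \<alpha> + \<beta> + 1)"
  have "poly (?L P + smult ?lam P) x = (\<Sum>s\<le>n. c s * (poly (?L (e s)) x + ?lam * E s))"
  proof -
    have P: "P = (\<Sum>s\<le>n. smult (c s) (e s))" unfolding P_def jacobi_poly_def c_def e_def ..
    have E: "poly (e s) x = E s" for s by (simp add: e_def E_def y_def z_def field_simps)
    show ?thesis
      unfolding P pderiv_sum pderiv_smult poly_add poly_mult poly_smult poly_sum E
        sum_distrib_left sum.distrib[symmetric]
      by (intro sum.cong refl) (simp only: algebra_simps)
  qed
  \<comment> \<open>With m = n - s, adding the eigenvalue turns the diagonal coefficient into s (s +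
    \<alpha>) + m (m + \<beta>), which is the sum of the two off-diagonal coefficients up to sign;
    only differences of neighbours remain.\<close>
  also have "\<dots> = (\<Sum>s\<le>n. w s * (E s - E (s - 1))) - (\<Sum>s\<le>n. v s * (E (Suc s) - E s))"
    unfolding sum_subtractf[symmetric]
  proof (intro sum.cong refl)
    fix s assume "s \<in> {..n}"
    then obtain m where m: "n = s + m" using le_Suc_ex by auto
    have "s = 0 \<or> E (s - 1) = y ^ (s - 1) * z ^ Suc m" using m by (cases s) (auto simp: E_def)
    moreover have "m = 0 \<or> E (Suc s) = y ^ Suc s * z ^ (m - 1)" using m by (cases m) (auto simp: E_def)
    moreover have "E s = y ^ s * z ^ m" using m by (simp add: E_def)
    ultimately have "c s * (poly (?L (e s)) x + ?lam * E s)
      = c s * (- (real s * (real s + \<alpha>) * E (s - 1))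
          - (2 * real s * real m + (\<beta> + 1) * real s + (\<alpha> + 1) * real m) * E s
          - real m * (real m + \<beta>) * E (Suc s) + ?lam * E s)"
      unfolding e_def poly_diff_operator_product m add_diff_cancel_left' y_def[symmetric] z_def[symmetric] by auto
    also have "\<dots> = w s * (E s - E (s - 1)) - v s * (E (Suc s) - E s)"
      unfolding w_def v_def using m by (simp add: algebra_simps)
    finally show "c s * (poly (?L (e s)) x + ?lam * E s) = w s * (E s - E (s - 1)) - v s * (E (Suc s) - E s)" .
  qed
  also have "(\<Sum>s\<le>n. w s * (E s - E (s - 1))) = (\<Sum>s<n. w (Suc s) * (E (Suc s) - E s))"
    unfolding lessThan_Suc_atMost[symmetric] sum.lessThan_Suc_shift by (simp add: w_def)
  also have "\<dots> = (\<Sum>s<n. v s * (E (Suc s) - E s))" using wv by (intro sum.cong) auto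
  also have "(\<Sum>s\<le>n. v s * (E (Suc s) - E s)) = (\<Sum>s<n. v s * (E (Suc s) - E s))"
    unfolding lessThan_Suc_atMost[symmetric] by (simp add: v_def)
  finally show "poly (?L P) x = poly (smult (- ?lam) P) x" by simp
qed

text \<open>
  The polynomial \<open>q\<close> in the proof is of virial type: integrating its divergence eliminates all
  derivatives of \<open>P\<close> and shows that the mean of \<open>x\<^sup>2\<close> under \<open>P\<^sup>2 d\<mu>\<close> is about one half. In particular
  the mass of \<open>P\<^sup>2 d\<mu>\<close> does not concentrate at the endpoints.
\<close>

lemma jacobi_poly_mass:
  fixes \<alpha> \<beta> :: real
  assumes ab: "\<alpha> > -1" "\<beta> > -1" and sum: "\<alpha> + \<beta> > -1"
  obtains C where "\<And>n. (2 * (real n * (real n + \<alpha> + \<beta> + 1)) - C) * jacobi_norm_sq \<alpha> \<beta> n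
    \<le> 4 * (real n * (real n + \<alpha> + \<beta> + 1))
        * (LINT x|jacobi_measure \<alpha> \<beta>. poly ([:1, 0, -1:] * (jacobi_poly \<alpha> \<beta> n)\<^sup>2) x)"
proof -
  let ?M = "jacobi_measure \<alpha> \<beta>"
  define A where "A = [:1, 0, -1::real:]"
  define B where "B = [:\<beta> - \<alpha>, - (\<alpha> + \<beta> + 2):]"
  \<comment> \<open>This is (1 - x^2) - 2 x^2 - x \<open>B\<close>(x), the unique choice for which
    the terms with the square of P' cancel below.\<close>
  define k where "k = [:1, - (\<beta> - \<alpha>), \<alpha> + \<beta> - 1:]"
  \<comment> \<open>The part of the divergence without the factor \<open>lam\<close>. It does not
    depend on n, hence neither does its bound \<open>C\<close>.\<close>
  define r where "r = smult (1 / 2) (A * pderiv (pderiv k) + B * pderiv k)"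
  have "bounded (poly r ` {-1..1})"
    by (intro compact_imp_bounded compact_continuous_image continuous_intros) auto
  then obtain C where "\<forall>y\<in>poly r ` {-1..1}. norm y \<le> C" unfolding bounded_iff by blast
  then have C: "\<And>x. x \<in> {-1..1} \<Longrightarrow> \<bar>poly r x\<bar> \<le> C" by auto
  show thesis
  proof (rule that[of C])
    fix n
    define P where "P = jacobi_poly \<alpha> \<beta> n"
    define lam where "lam = real n * (real n + \<alpha> + \<beta> + 1)"
    \<comment> \<open>The first summand is the virial density. The second cancels the product P P'
      with factor \<open>lam\<close>, the third cancels the square of P', and the last the products
      P P' that the third creates. What survives with \<open>lam\<close> is 2 - 4 x^2 = 4 (1 - x^2)
      - 2 times the square of P.\<close>
    define q where "q = [:0, 1:] * A * (pderiv P)\<^sup>2 + smult lam ([:0, 1:] * P\<^sup>2)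
      - k * P * pderiv P + smult (1 / 2) (pderiv k * P\<^sup>2)"
    have int: "integrable ?M (poly p)" for p by (rule jacobi_measure_poly_integrable[OF ab])
    have key: "poly (A * pderiv q + B * q) x = poly (smult (2 * lam) (P\<^sup>2) - smult (4 * lam) ([:0, 0, 1:] * P\<^sup>2) + r * P\<^sup>2) x" for x
    proof -
      define a b p p1 p2 where "a = poly A x" and "b = poly B x" and "p = poly P x"
        and "p1 = poly (pderiv P) x" and "p2 = poly (pderiv (pderiv P)) x"
      have ode: "a * p2 = - b * p1 - lam * p"
        using arg_cong[OF jacobi_poly_ode[of \<alpha> \<beta> n], of "\<lambda>p. poly p x"]
        unfolding P_def[symmetric] A_def[symmetric] B_def[symmetric] lam_def[symmetric]
        by (simp add: a_def b_def p_def p1_def p2_def)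
      define k0 k1 k2 where "k0 = poly k x" and "k1 = poly (pderiv k) x" and "k2 = poly (pderiv (pderiv k)) x"
      have dA: "poly (pderiv A) x = - 2 * x" by (simp add: A_def pderiv_pCons)
      have k0: "k0 = a - 2 * x\<^sup>2 - x * b"
        by (simp add: k0_def k_def a_def A_def b_def B_def algebra_simps power2_eq_square)
      have a: "a = 1 - x\<^sup>2" by (simp add: a_def A_def power2_eq_square)
      have "poly (A * pderiv q + B * q) x
        = a * (a * p1\<^sup>2 + x * (- 2 * x) * p1\<^sup>2 + 2 * x * p1 * (a * p2)) + lam * a * (p\<^sup>2 + 2 * x * p * p1)
          - (a * k1 * p * p1 + a * k0 * p1\<^sup>2 + k0 * p * (a * p2))
          + 1 / 2 * (a * k2 * p\<^sup>2 + 2 * a * k1 * p * p1)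
          + b * (x * a * p1\<^sup>2 + lam * (x * p\<^sup>2) - k0 * p * p1 + 1 / 2 * (k1 * p\<^sup>2))"
        unfolding q_def
        by (simp add: pderiv_add pderiv_diff pderiv_mult pderiv_smult pderiv_power pderiv_pCons dA
            power2_eq_square flip: a_def b_def p_def p1_def p2_def k0_def k1_def k2_def)
           (simp add: algebra_simps)
      also have "\<dots> = lam * (a + x * b + k0) * p\<^sup>2 + 1 / 2 * (a * k2 + b * k1) * p\<^sup>2"
        unfolding ode k0 by (simp add: algebra_simps power2_eq_square)
      also have "a + x * b + k0 = 2 - 4 * x\<^sup>2" unfolding k0 a by (simp add: algebra_simps)
      finally show ?thesis
        by (simp add: r_def a_def b_def p_def k1_def k2_def power2_eq_square algebra_simps)
    qed
    have "0 = (LINT x|?M. poly (A * pderiv q + B * q) x)"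
      using jacobi_integration_by_parts[OF ab, of q]
      unfolding A_def B_def by (metis has_bochner_integral_integral_eq)
    also have "\<dots> \<le> (LINT x|?M. 4 * lam * poly (A * P\<^sup>2) x - (2 * lam - C) * poly (P\<^sup>2) x)"
    proof (rule integral_mono)
      fix x assume "x \<in> space ?M"
      then have "x \<in> {-1..1}" by (simp add: jacobi_measure_def space_restrict_space)
      then have "poly r x \<le> C" using C by (fastforce simp: abs_le_iff)
      then have "poly r x * (poly P x)\<^sup>2 \<le> C * (poly P x)\<^sup>2" by (intro mult_right_mono) auto
      then show "poly (A * pderiv q + B * q) x \<le> 4 * lam * poly (A * P\<^sup>2) x - (2 * lam - C) * poly (P\<^sup>2) x"
        unfolding key by (simp add: A_def algebra_simps power2_eq_square)
    qed (intro Bochner_Integration.integrable_diff integrable_mult_right int)+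
    also have "\<dots> = 4 * lam * (LINT x|?M. poly (A * P\<^sup>2) x) - (2 * lam - C) * jacobi_norm_sq \<alpha> \<beta> n"
      unfolding jacobi_norm_sq_eq_poly P_def[symmetric]
      by (subst Bochner_Integration.integral_diff)
         (simp_all add: int integrable_mult_right del: poly_mult poly_power)
    finally show "(2 * (real n * (real n + \<alpha> + \<beta> + 1)) - C) * jacobi_norm_sq \<alpha> \<beta> n
      \<le> 4 * (real n * (real n + \<alpha> + \<beta> + 1))
        * (LINT x|jacobi_measure \<alpha> \<beta>. poly ([:1, 0, -1:] * (jacobi_poly \<alpha> \<beta> n)\<^sup>2) x)"
      unfolding lam_def A_def P_def by linarith
  qed
qed

subsection \<open>Oscillation of the Jacobi polynomials\<close>

text \<open>A weak form of the Lebesgue density theorem. If more than a quarter of every interval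
  lay outside E, then any cover by nonoverlapping intervals would have measure at most four times
  its excess over E; a cover with excess at most one eighth of the measure of E contradicts
  this.\<close>

lemma ex_interval_density:
  fixes E :: "real set"
  assumes E: "E \<in> lmeasurable" "E \<subseteq> {a..b}" and pos: "measure lebesgue E > 0"
  obtains c d where "c < d" "measure lebesgue ({c..d} - E) \<le> (d - c) / 4"
proof (rule ccontr)
  assume "\<not> thesis"
  then have contra: "\<And>c d. c < d \<Longrightarrow> measure lebesgue ({c..d} - E) > (d - c) / 4"
    using that by force
  let ?m = "measure lebesgue E"
  define e where "e = ?m / 8"
  have "e > 0" using pos by (simp add: e_def)
  have ne: "box a b \<noteq> {}"
  proof
    assume "box a b = {}"
    then have "{a..b} \<subseteq> {a}" by auto
    then have "negligible E" using E(2) by (meson negligible_sing negligible_subset)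
    then show False using pos by (simp add: negligible_imp_measure0)
  qed
  obtain D where D: "countable D"
      "\<And>K. K \<in> D \<Longrightarrow> K \<subseteq> cbox a b \<and> K \<noteq> {} \<and> (\<exists>c d. K = cbox c d)"
      "pairwise (\<lambda>A B. interior A \<inter> interior B = {}) D"
      "\<And>K. \<lbrakk>K \<in> D; box a b \<noteq> {}\<rbrakk> \<Longrightarrow> interior K \<noteq> {}"
      "E \<subseteq> \<Union>D" "\<Union>D \<in> lmeasurable" "measure lebesgue (\<Union>D) \<le> ?m + e"
    using measurable_outer_intervals_bounded[of E a b e] E \<open>e > 0\<close> by (metis box_real(2))
  have meas: "K \<in> lmeasurable" if "K \<in> D" for K using D(2)[OF that] by auto
  have neg: "pairwise (\<lambda>A B. negligible (A \<inter> B)) D"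
  proof (rule pairwiseI)
    fix A B assume AB: "A \<in> D" "B \<in> D" "A \<noteq> B"
    then have "interior (A \<inter> B) = {}" using D(3) by (simp add: pairwise_def)
    moreover have "convex (A \<inter> B)" using D(2)[OF AB(1)] D(2)[OF AB(2)] by auto
    ultimately show "negligible (A \<inter> B)" by (simp add: negligible_convex_interior)
  qed
  have rest: "measure lebesgue (\<Union>D - E) \<le> e"
    using D(5-7) E(1) by (simp add: measurable_measure_Diff fmeasurableD)
  have "measure lebesgue (\<Union>F) \<le> 4 * e" if F: "F \<subseteq> D" "finite F" for F
  proof -
    have "measure lebesgue (\<Union>F) = (\<Sum>K\<in>F. measure lebesgue K)"
      using F meas by (intro measure_negligible_finite_Union pairwise_subset[OF neg]) auto
    also have "\<dots> \<le> (\<Sum>K\<in>F. 4 * measure lebesgue (K - E))"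
    proof (rule sum_mono)
      fix K assume "K \<in> F"
      then have K: "K \<in> D" using F by auto
      from D(2)[OF K] obtain c d where cd: "K = {c..d}" by auto
      have "c < d" using D(4)[OF K ne] cd by auto
      then show "measure lebesgue K \<le> 4 * measure lebesgue (K - E)"
        using contra[of c d] cd by simp
    qed
    also have "\<dots> = 4 * measure lebesgue (\<Union>K\<in>F. K - E)"
    proof (subst measure_negligible_finite_Union_image)
      show "pairwise (\<lambda>x y. negligible ((x - E) \<inter> (y - E))) F"
        using pairwise_subset[OF neg F(1)] by (rule pairwise_mono) (auto intro: negligible_subset)
    qed (use F meas E in \<open>auto simp: sum_distrib_left intro!: fmeasurable_Diff fmeasurableD\<close>)
    also have "measure lebesgue (\<Union>K\<in>F. K - E) \<le> measure lebesgue (\<Union>D - E)"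
      using F meas D E
      by (intro measure_mono_fmeasurable)
         (auto intro!: sets.finite_UN sets.Diff fmeasurable_Diff dest: fmeasurableD)
    finally show ?thesis using rest by simp
  qed
  then have "measure lebesgue (\<Union>K\<in>D. K) \<le> 4 * e"
    using D(1) meas by - (rule measure_UN_bound, auto)
  moreover have "?m \<le> measure lebesgue (\<Union>D)"
    using D E by (intro measure_mono_fmeasurable) (auto dest: fmeasurableD)
  ultimately show False using pos by (simp add: e_def)
qed

lemma Brahmagupta_identity:
  fixes a b c s :: "'a :: comm_ring_1"
  shows "(a\<^sup>2 + b\<^sup>2) * (s\<^sup>2 + c\<^sup>2) = (a * c + b * s)\<^sup>2 + (a * s - b * c)\<^sup>2"
  by (simp add: power2_eq_square algebra_simps)

text \<open>Let R be the squared amplitude. Over an interval the square of the oscillation has mean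
  close to R/2. If it stayed below R/16 on E, which fills three quarters of the interval, the mean
  would be at most R/16 + R/4 = 5R/16.\<close>

lemma trig_large_on_set:
  fixes E :: "real set"
  assumes E: "E \<in> lmeasurable" "E \<subseteq> {a..b}" and pos: "measure lebesgue E > 0"
  obtains N0 where "N0 > 0"
    "\<And>N A B. N \<ge> N0 \<Longrightarrow> \<exists>\<theta>\<in>E. sqrt (A\<^sup>2 + B\<^sup>2) \<le> 4 * \<bar>A * cos (N * \<theta>) + B * sin (N * \<theta>)\<bar>"
proof -
  obtain c d where cd: "c < d" "measure lebesgue ({c..d} - E) \<le> (d - c) / 4"
    using ex_interval_density[OF assms] by blast
  \<comment> \<open>The gap between the means is 3/16 of R, and the oscillating part of the
    antiderivative contributes at most R/N; 1/6 is less than 3/16.\<close>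
  define N0 where "N0 = 6 / (d - c)"
  have "N0 > 0" using cd by (simp add: N0_def)
  moreover have "\<exists>\<theta>\<in>E. sqrt (A\<^sup>2 + B\<^sup>2) \<le> 4 * \<bar>A * cos (N * \<theta>) + B * sin (N * \<theta>)\<bar>" if N: "N \<ge> N0" for N A B
  proof (rule ccontr)
    assume neg: "\<not> ?thesis"
    define R where "R = A\<^sup>2 + B\<^sup>2"
    define y where "y \<theta> = A * cos (N * \<theta>) + B * sin (N * \<theta>)" for \<theta>
    have N0: "N > 0" using N \<open>N0 > 0\<close> by simp
    have R0: "R \<ge> 0" by (simp add: R_def)
    have small: "(y \<theta>)\<^sup>2 \<le> R / 16" if "\<theta> \<in> E" for \<theta>
    proof -
      have "4 * \<bar>y \<theta>\<bar> \<le> sqrt R" using neg that unfolding y_def R_def by force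
      then have "(4 * \<bar>y \<theta>\<bar>)\<^sup>2 \<le> (sqrt R)\<^sup>2" by (intro power_mono) auto
      then show ?thesis using R0 by (simp add: power_mult_distrib)
    qed
    have yR: "(y \<theta>)\<^sup>2 \<le> R" for \<theta>
    proof -
      have "R = (y \<theta>)\<^sup>2 + (A * sin (N * \<theta>) - B * cos (N * \<theta>))\<^sup>2"
        using Brahmagupta_identity[of A B "sin (N * \<theta>)" "cos (N * \<theta>)"] by (simp add: R_def y_def)
      then show ?thesis by simp
    qed
    obtain \<theta>0 where "\<theta>0 \<in> E" using pos by fastforce
    have Rpos: "R > 0"
    proof (rule ccontr)
      assume "\<not> R > 0"
      then have "R = 0" using R0 by linarith
      then have "sqrt (A\<^sup>2 + B\<^sup>2) = 0" by (simp add: R_def)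
      then show False using neg \<open>\<theta>0 \<in> E\<close> by force
    qed
    define G where "G \<theta> = R / 2 * \<theta> + (A\<^sup>2 - B\<^sup>2) / (4 * N) * sin (2 * (N * \<theta>)) - A * B / (2 * N) * cos (2 * (N * \<theta>))" for \<theta>
    have "((\<lambda>\<theta>. (y \<theta>)\<^sup>2) has_integral (G d - G c)) {c..d}"
    proof (rule fundamental_theorem_of_calculus)
      fix \<theta> assume "\<theta> \<in> {c..d}"
      have "(G has_real_derivative R / 2 + (A\<^sup>2 - B\<^sup>2) / 2 * cos (2 * (N * \<theta>)) + A * B * sin (2 * (N * \<theta>))) (at \<theta>)"
        unfolding G_def using N0 by (auto intro!: derivative_eq_intros simp: field_simps)
      also have "R / 2 + (A\<^sup>2 - B\<^sup>2) / 2 * cos (2 * (N * \<theta>)) + A * B * sin (2 * (N * \<theta>)) = (y \<theta>)\<^sup>2"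
      proof -
        have "R' / 2 * (s\<^sup>2 + c\<^sup>2) + (A\<^sup>2 - B\<^sup>2) / 2 * (c\<^sup>2 - s\<^sup>2) + A * B * (2 * s * c) = (A * c + B * s)\<^sup>2"
          if "R' = A\<^sup>2 + B\<^sup>2" for s c R' :: real
          unfolding that by (simp add: power2_eq_square field_simps)
        from this[OF R_def, of "sin (N * \<theta>)" "cos (N * \<theta>)"] show ?thesis
          unfolding cos_double sin_double y_def by simp
      qed
      finally show "(G has_vector_derivative (y \<theta>)\<^sup>2) (at \<theta> within {c..d})"
        by (simp add: has_real_derivative_iff_has_vector_derivative has_vector_derivative_at_within)
    qed (use cd in auto)
    moreover have "((\<lambda>\<theta>. R / 16 + R * indicator ({c..d} - E) \<theta>) has_integral
        ((d - c) * (R / 16) + R * measure lebesgue ({c..d} - E))) {c..d}"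
    proof (intro has_integral_add has_integral_mult_right)
      show "((\<lambda>\<theta>. R / 16) has_integral (d - c) * (R / 16)) {c..d}"
        using has_integral_const_real[of "R / 16" c d] cd by simp
      have "{c..d} - E \<in> lmeasurable" using E by (intro fmeasurable_Diff) (auto dest: fmeasurableD)
      then have "(indicat_real ({c..d} - E) has_integral measure lebesgue ({c..d} - E)) UNIV"
        by (simp only: lmeasurable_iff_has_integral)
      moreover have "indicat_real ({c..d} - E) = (\<lambda>x. if x \<in> {c..d} then indicat_real ({c..d} - E) x else 0)"
        by (auto simp: fun_eq_iff indicator_def)
      ultimately show "(indicat_real ({c..d} - E) has_integral measure lebesgue ({c..d} - E)) {c..d}"
        by (metis has_integral_restrict_UNIV)
    qed
    ultimately have "G d - G c \<le> (d - c) * (R / 16) + R * measure lebesgue ({c..d} - E)"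
    proof (rule has_integral_le)
      fix \<theta> assume "\<theta> \<in> {c..d}"
      then show "(y \<theta>)\<^sup>2 \<le> R / 16 + R * indicator ({c..d} - E) \<theta>"
        using small[of \<theta>] yR[of \<theta>] R0 by (cases "\<theta> \<in> E") (auto simp: indicator_def)
    qed
    also have "\<dots> \<le> (d - c) * (R / 16) + R * ((d - c) / 4)"
      using cd R0 by (intro add_left_mono mult_left_mono) auto
    finally have up: "G d - G c \<le> 5 / 16 * (R * (d - c))" by (simp add: field_simps)
    have osc: "\<bar>G \<theta> - R / 2 * \<theta>\<bar> \<le> R / (2 * N)" for \<theta>
    proof -
      have AB: "\<bar>A\<^sup>2 - B\<^sup>2\<bar> \<le> R" by (auto simp: R_def abs_le_iff)
      have AB2: "\<bar>A * B\<bar> \<le> R / 2"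
        using zero_le_power2[of "A - B"] zero_le_power2[of "A + B"]
        by (auto simp: R_def abs_le_iff power2_eq_square algebra_simps)
      have "\<bar>G \<theta> - R / 2 * \<theta>\<bar> \<le> \<bar>(A\<^sup>2 - B\<^sup>2) / (4 * N)\<bar> * \<bar>sin (2 * (N * \<theta>))\<bar> + \<bar>A * B / (2 * N)\<bar> * \<bar>cos (2 * (N * \<theta>))\<bar>"
        unfolding G_def abs_mult[symmetric] by linarith
      also have "\<bar>(A\<^sup>2 - B\<^sup>2) / (4 * N)\<bar> = \<bar>A\<^sup>2 - B\<^sup>2\<bar> / (4 * N)" using N0 by (simp add: abs_divide)
      also have "\<bar>A * B / (2 * N)\<bar> = \<bar>A * B\<bar> / (2 * N)" using N0 by (simp add: abs_divide)
      also have "\<bar>A\<^sup>2 - B\<^sup>2\<bar> / (4 * N) * \<bar>sin (2 * (N * \<theta>))\<bar> + \<bar>A * B\<bar> / (2 * N) * \<bar>cos (2 * (N * \<theta>))\<bar>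
          \<le> R / (4 * N) * 1 + (R / 2) / (2 * N) * 1"
        by (intro add_mono mult_mono divide_right_mono AB AB2) (use N0 R0 in auto)
      finally show ?thesis by (simp add: field_simps)
    qed
    have "R / 2 * d - R / 2 * c - R / N \<le> G d - G c"
    proof -
      have "R / N = R / (2 * N) + R / (2 * N)" by simp
      then show ?thesis using osc[of d] osc[of c] unfolding abs_le_iff by linarith
    qed
    also note up
    finally have "R * (d - c) / 2 - R / N \<le> 5 / 16 * (R * (d - c))"
      by (simp add: right_diff_distrib diff_divide_distrib)
    then have "3 / 16 * (R * (d - c)) \<le> R / N" by simp
    then have "R * (3 / 16 * (d - c)) \<le> R * (1 / N)" by (simp add: mult_ac)
    then have "3 / 16 * (d - c) \<le> 1 / N" using Rpos by (subst (asm) mult_le_cancel_left_pos) auto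
    also have "1 / N \<le> 1 / N0" using N \<open>N0 > 0\<close> by (intro divide_left_mono) auto
    finally show False using cd by (simp add: N0_def field_simps)
  qed
  ultimately show thesis by (rule that)
qed

text \<open>Variation of constants: the coefficients of \<open>cos (N \<theta>)\<close> and \<open>sin (N \<theta>)\<close> vary by \<open>O(1 / N)\<close>.\<close>

lemma oscillator_approx:
  fixes u w q :: "real \<Rightarrow> real"
  assumes N: "N > 0"
    and u: "\<And>\<theta>. \<theta> \<in> {a..b} \<Longrightarrow> (u has_real_derivative w \<theta>) (at \<theta>)"
    and w: "\<And>\<theta>. \<theta> \<in> {a..b} \<Longrightarrow> (w has_real_derivative - (N\<^sup>2 + q \<theta>) * u \<theta>) (at \<theta>)"
    and q: "\<And>\<theta>. \<theta> \<in> {a..b} \<Longrightarrow> \<bar>q \<theta>\<bar> \<le> Q"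
    and M: "\<And>\<theta>. \<theta> \<in> {a..b} \<Longrightarrow> \<bar>u \<theta>\<bar> \<le> M"
  obtains A B where "\<And>\<theta>. \<theta> \<in> {a..b} \<Longrightarrow>
    \<bar>u \<theta> - (A * cos (N * \<theta>) + B * sin (N * \<theta>))\<bar> \<le> 2 * Q * (b - a) / N * M"
proof -
  \<comment> \<open>\<open>A\<close> and \<open>B\<close> are u and w/N rotated back by the phase N
    \<theta>. They would be constant for q = 0, so only q enters their derivatives.\<close>
  define A where "A \<theta> = u \<theta> * cos (N * \<theta>) - w \<theta> / N * sin (N * \<theta>)" for \<theta>
  define B where "B \<theta> = u \<theta> * sin (N * \<theta>) + w \<theta> / N * cos (N * \<theta>)" for \<theta>
  have dA: "(A has_real_derivative sin (N * \<theta>) / N * q \<theta> * u \<theta>) (at \<theta>)" if "\<theta> \<in> {a..b}" for \<theta>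
    unfolding A_def using N
    by (auto intro!: derivative_eq_intros u[OF that] w[OF that] simp: field_simps power2_eq_square)
  have dB: "(B has_real_derivative - cos (N * \<theta>) / N * q \<theta> * u \<theta>) (at \<theta>)" if "\<theta> \<in> {a..b}" for \<theta>
    unfolding B_def using N
    by (auto intro!: derivative_eq_intros u[OF that] w[OF that] simp: field_simps power2_eq_square)
  have var: "\<bar>F \<theta> - F a\<bar> \<le> Q * (b - a) / N * M"
    if F: "\<And>\<theta>. \<theta> \<in> {a..b} \<Longrightarrow> (F has_real_derivative s \<theta> / N * q \<theta> * u \<theta>) (at \<theta>)"
      and s: "\<And>\<theta>. \<bar>s \<theta>\<bar> \<le> 1" and th: "\<theta> \<in> {a..b}" for F s \<theta>
  proof -
    have Q0: "Q \<ge> 0" "M \<ge> 0" using q[OF th] M[OF th] by linarith+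
    have "norm (F \<theta> - F a) \<le> (Q / N * M) * norm (\<theta> - a)"
    proof (rule field_differentiable_bound[of "{a..b}"])
      fix t assume t: "t \<in> {a..b}"
      show "(F has_field_derivative s t / N * q t * u t) (at t within {a..b})"
        using F[OF t] by (rule has_field_derivative_at_within)
      have "\<bar>s t\<bar> / N * \<bar>q t\<bar> * \<bar>u t\<bar> \<le> 1 / N * Q * M"
        using s q[OF t] M[OF t] N Q0 by (intro mult_mono divide_right_mono) auto
      then show "norm (s t / N * q t * u t) \<le> Q / N * M" using N by (simp add: abs_mult)
    qed (use th in auto)
    also have "\<dots> \<le> (Q / N * M) * (b - a)"
      using th N Q0 by (intro mult_left_mono) auto
    finally show ?thesis by (simp add: field_simps)
  qed
  show thesis
  proof (rule that[of "A a" "B a"])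
    fix \<theta> assume th: "\<theta> \<in> {a..b}"
    let ?c = "cos (N * \<theta>)" and ?s = "sin (N * \<theta>)"
    have "(x * c - y * s) * c + (x * s + y * c) * s = x * (s\<^sup>2 + c\<^sup>2)" for x y c s :: real
      by (simp add: algebra_simps power2_eq_square)
    from this[of "u \<theta>" ?c "w \<theta> / N" ?s] have "u \<theta> = A \<theta> * ?c + B \<theta> * ?s"
      unfolding A_def B_def by simp
    then have "u \<theta> - (A a * ?c + B a * ?s) = (A \<theta> - A a) * ?c + (B \<theta> - B a) * ?s"
      by (simp add: algebra_simps)
    also have "\<bar>\<dots>\<bar> \<le> \<bar>A \<theta> - A a\<bar> * \<bar>?c\<bar> + \<bar>B \<theta> - B a\<bar> * \<bar>?s\<bar>"
      unfolding abs_mult[symmetric] by (rule abs_triangle_ineq)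
    also have "\<dots> \<le> \<bar>A \<theta> - A a\<bar> * 1 + \<bar>B \<theta> - B a\<bar> * 1"
      by (intro add_mono mult_left_mono) auto
    also have "\<dots> \<le> Q * (b - a) / N * M + Q * (b - a) / N * M"
      unfolding mult_1_right
      by (intro add_mono var[of A "\<lambda>\<theta>. sin (N * \<theta>)"] var[of B "\<lambda>\<theta>. - cos (N * \<theta>)"] dA dB th) auto
    finally show "\<bar>u \<theta> - (A a * ?c + B a * ?s)\<bar> \<le> 2 * Q * (b - a) / N * M"
      by (simp add: mult_ac)
  qed
qed

text \<open>The threshold depends on E, the interval and the bound of q, but not on the solution, so
  it serves all degrees at once. The approximation error is proportional to the unknown supremum of
  u and can be absorbed.\<close>

lemma oscillator_sup_le:
  fixes E :: "real set"
  assumes E: "E \<in> lmeasurable" "E \<subseteq> {a..b}" and pos: "measure lebesgue E > 0"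
  obtains N0 where "\<And>N u w q K \<theta>. \<lbrakk>N \<ge> N0;
      \<And>\<theta>. \<theta> \<in> {a..b} \<Longrightarrow> (u has_real_derivative w \<theta>) (at \<theta>);
      \<And>\<theta>. \<theta> \<in> {a..b} \<Longrightarrow> (w has_real_derivative - (N\<^sup>2 + q \<theta>) * u \<theta>) (at \<theta>);
      \<And>\<theta>. \<theta> \<in> {a..b} \<Longrightarrow> \<bar>q \<theta>\<bar> \<le> Q;
      \<And>\<theta>. \<theta> \<in> E \<Longrightarrow> \<bar>u \<theta>\<bar> \<le> K; \<theta> \<in> {a..b}\<rbrakk> \<Longrightarrow> \<bar>u \<theta>\<bar> \<le> 8 * K"
proof -
  obtain N1 where N1: "N1 > 0"
    "\<And>N A B. N \<ge> N1 \<Longrightarrow> \<exists>\<theta>\<in>E. sqrt (A\<^sup>2 + B\<^sup>2) \<le> 4 * \<bar>A * cos (N * \<theta>) + B * sin (N * \<theta>)\<bar>"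
    using trig_large_on_set[OF assms] by blast
  show thesis
  proof (rule that[of "max N1 (20 * Q * (b - a))"])
    fix N u w q K \<theta>
    assume N: "max N1 (20 * Q * (b - a)) \<le> N"
      and u: "\<And>\<theta>. \<theta> \<in> {a..b} \<Longrightarrow> (u has_real_derivative w \<theta>) (at \<theta>)"
      and w: "\<And>\<theta>. \<theta> \<in> {a..b} \<Longrightarrow> (w has_real_derivative - (N\<^sup>2 + q \<theta>) * u \<theta>) (at \<theta>)"
      and q: "\<And>\<theta>. \<theta> \<in> {a..b} \<Longrightarrow> \<bar>q \<theta>\<bar> \<le> Q"
      and K: "\<And>\<theta>. \<theta> \<in> E \<Longrightarrow> \<bar>u \<theta>\<bar> \<le> K" and \<theta>: "\<theta> \<in> {a..b}"
    have Npos: "N > 0" using N N1 by simp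
    have "continuous_on {a..b} (\<lambda>\<theta>. \<bar>u \<theta>\<bar>)"
      using u by (intro continuous_on_rabs continuous_at_imp_continuous_on) (auto intro!: DERIV_isCont[OF u])
    then obtain t where t: "t \<in> {a..b}" "\<And>\<theta>. \<theta> \<in> {a..b} \<Longrightarrow> \<bar>u \<theta>\<bar> \<le> \<bar>u t\<bar>"
      using continuous_attains_sup[of "{a..b}" "\<lambda>\<theta>. \<bar>u \<theta>\<bar>"] \<theta> by auto
    define M where "M = \<bar>u t\<bar>"
    \<comment> \<open>The constant 20 in the threshold makes this relative error at most 1/10. With
      amplitude \<rho>, M \<le> \<rho> + M/10 and \<rho> \<le> 4 (K + M/10) give M \<le> 4 K + M/2,
      hence the factor 8.\<close>
    define \<epsilon> where "\<epsilon> = 2 * Q * (b - a) / N"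
    have \<epsilon>: "\<epsilon> * M \<le> 1 / 10 * M"
      unfolding \<epsilon>_def M_def using N Npos by (intro mult_right_mono) (auto simp: field_simps)
    obtain A B where AB: "\<And>\<theta>. \<theta> \<in> {a..b} \<Longrightarrow> \<bar>u \<theta> - (A * cos (N * \<theta>) + B * sin (N * \<theta>))\<bar> \<le> \<epsilon> * M"
      unfolding \<epsilon>_def M_def
      using oscillator_approx[OF Npos u w q t(2)] by blast
    define \<rho> where "\<rho> = sqrt (A\<^sup>2 + B\<^sup>2)"
    have "\<bar>A * cos (N * t) + B * sin (N * t)\<bar> \<le> \<rho>"
    proof -
      have "A\<^sup>2 + B\<^sup>2 = (A * cos (N * t) + B * sin (N * t))\<^sup>2 + (A * sin (N * t) - B * cos (N * t))\<^sup>2"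
        using Brahmagupta_identity[of A B "sin (N * t)" "cos (N * t)"] by simp
      then show ?thesis unfolding \<rho>_def by (intro real_le_rsqrt) auto
    qed
    then have "M \<le> \<rho> + \<epsilon> * M" using AB[OF t(1)] unfolding M_def by linarith
    moreover obtain s where s: "s \<in> E" "\<rho> \<le> 4 * \<bar>A * cos (N * s) + B * sin (N * s)\<bar>"
      using N1(2)[of N A B] N unfolding \<rho>_def by auto
    moreover have "\<bar>A * cos (N * s) + B * sin (N * s)\<bar> \<le> K + \<epsilon> * M"
      using AB[of s] K[OF s(1)] s(1) E(2) by (auto simp: abs_le_iff)
    ultimately have "M \<le> \<rho> + \<epsilon> * M" "\<rho> \<le> 4 * (K + \<epsilon> * M)" by auto
    then have "M \<le> 8 * K" using \<epsilon> by (simp add: algebra_simps)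
    then show "\<bar>u \<theta>\<bar> \<le> 8 * K" using t(2)[OF \<theta>] by (simp add: M_def)
  qed
qed

text \<open>
  Liouville normal form: the factor \<open>g\<close>, with \<open>g' = g k\<close>, removes the first-order term of the
  Jacobi equation in the variable \<open>\<theta>\<close>, \<open>x = cos \<theta>\<close>.
\<close>

lemma jacobi_liouville:
  fixes \<alpha> \<beta> :: real and n :: nat
  defines "P \<equiv> jacobi_poly \<alpha> \<beta> n"
    and "g \<equiv> \<lambda>\<theta>. exp ((\<alpha> + 1 / 2) / 2 * ln (1 - cos \<theta>) + (\<beta> + 1 / 2) / 2 * ln (1 + cos \<theta>))"
    and "k \<equiv> \<lambda>\<theta>. ((\<alpha> - \<beta>) + (\<alpha> + \<beta> + 1) * cos \<theta>) / (2 * sin \<theta>)"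
    and "k' \<equiv> \<lambda>\<theta>. - ((\<alpha> + \<beta> + 1) + (\<alpha> - \<beta>) * cos \<theta>) / (2 * (sin \<theta>)\<^sup>2)"
  assumes "0 < \<theta>" "\<theta> < pi"
  shows "((\<lambda>\<theta>. g \<theta> * poly P (cos \<theta>)) has_real_derivative
      g \<theta> * (k \<theta> * poly P (cos \<theta>) - sin \<theta> * poly (pderiv P) (cos \<theta>))) (at \<theta>)" (is ?th1)
    and "((\<lambda>\<theta>. g \<theta> * (k \<theta> * poly P (cos \<theta>) - sin \<theta> * poly (pderiv P) (cos \<theta>))) has_real_derivative
      - (real n * (real n + \<alpha> + \<beta> + 1) + - ((k \<theta>)\<^sup>2 + k' \<theta>)) * (g \<theta> * poly P (cos \<theta>))) (at \<theta>)" (is ?th2)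
proof -
  have s: "sin \<theta> > 0" using assms by (intro sin_gt_zero) auto
  have sc: "(sin \<theta>)\<^sup>2 + (cos \<theta>)\<^sup>2 = 1" by simp
  have c: "1 - cos \<theta> > 0" "1 + cos \<theta> > 0"
  proof -
    have "(1 - cos \<theta>) * (1 + cos \<theta>) > 0"
      using zero_less_power[OF s, of 2] unfolding sin_squared_eq by (simp add: power2_eq_square algebra_simps)
    then show "1 - cos \<theta> > 0" "1 + cos \<theta> > 0"
      using cos_le_one[of \<theta>] cos_ge_minus_one[of \<theta>] by (auto simp: zero_less_mult_iff)
  qed
  have ss: "sin \<theta> * sin \<theta> = (1 - cos \<theta>) * (1 + cos \<theta>)"
    using sc by (simp add: power2_eq_square algebra_simps)
  have dg: "(g has_real_derivative g \<theta> * k \<theta>) (at \<theta>)"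
  proof -
    have "(g has_real_derivative g \<theta> * ((\<alpha> + 1 / 2) / 2 * (sin \<theta> / (1 - cos \<theta>)) - (\<beta> + 1 / 2) / 2 * (sin \<theta> / (1 + cos \<theta>)))) (at \<theta>)"
    proof -
      have "((\<lambda>\<theta>. ln (1 - cos \<theta>)) has_real_derivative sin \<theta> / (1 - cos \<theta>)) (at \<theta>)"
        "((\<lambda>\<theta>. ln (1 + cos \<theta>)) has_real_derivative - (sin \<theta> / (1 + cos \<theta>))) (at \<theta>)"
        using c by (auto intro!: derivative_eq_intros simp: field_simps)
      from DERIV_fun_exp[OF DERIV_add[OF DERIV_cmult[OF this(1), of "(\<alpha> + 1 / 2) / 2"]
          DERIV_cmult[OF this(2), of "(\<beta> + 1 / 2) / 2"]]]
      show ?thesis unfolding g_def by simp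
    qed
    moreover have "sin \<theta> / (1 - cos \<theta>) = (1 + cos \<theta>) / sin \<theta>" "sin \<theta> / (1 + cos \<theta>) = (1 - cos \<theta>) / sin \<theta>"
      using c s ss by (simp_all add: frac_eq_eq)
    moreover have "(\<alpha> + 1 / 2) / 2 * ((1 + cos \<theta>) / sin \<theta>) - (\<beta> + 1 / 2) / 2 * ((1 - cos \<theta>) / sin \<theta>) = k \<theta>"
      unfolding k_def using s by (simp add: field_simps)
    ultimately show ?thesis by simp
  qed
  have dk: "(k has_real_derivative k' \<theta>) (at \<theta>)"
  proof -
    have num: "(- (p * s)) * (2 * s) - (r + p * c) * (2 * c) = - 2 * (p * (s\<^sup>2 + c\<^sup>2) + r * c)" for p r s c :: real
    proof -
      have "- (p * s) * (2 * s) = - 2 * (p * s\<^sup>2)" "(r + p * c) * (2 * c) = 2 * (r * c) + 2 * (p * c\<^sup>2)"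
        by (simp_all add: power2_eq_square distrib_right)
      then show ?thesis by (simp add: distrib_left)
    qed
    have "(k has_real_derivative
      ((- ((\<alpha> + \<beta> + 1) * sin \<theta>)) * (2 * sin \<theta>) - ((\<alpha> - \<beta>) + (\<alpha> + \<beta> + 1) * cos \<theta>) * (2 * cos \<theta>)) / (2 * sin \<theta> * (2 * sin \<theta>))) (at \<theta>)"
      unfolding k_def using s by (auto intro!: derivative_eq_intros)
    also have "(- ((\<alpha> + \<beta> + 1) * sin \<theta>)) * (2 * sin \<theta>) - ((\<alpha> - \<beta>) + (\<alpha> + \<beta> + 1) * cos \<theta>) * (2 * cos \<theta>)
      = - 2 * ((\<alpha> + \<beta> + 1) * ((sin \<theta>)\<^sup>2 + (cos \<theta>)\<^sup>2) + (\<alpha> - \<beta>) * cos \<theta>)"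
      by (rule num)
    also have "\<dots> / (2 * sin \<theta> * (2 * sin \<theta>)) = k' \<theta>"
      unfolding sc k'_def using s by (simp add: field_simps power2_eq_square)
    finally show ?thesis .
  qed
  have dP: "((\<lambda>\<theta>. poly p (cos \<theta>)) has_real_derivative - sin \<theta> * poly (pderiv p) (cos \<theta>)) (at \<theta>)" for p
    using DERIV_chain2[OF poly_DERIV DERIV_cos, of p \<theta>] by (simp add: mult.commute)
  show ?th1
    using DERIV_mult[OF dg dP[of P]] by (simp add: algebra_simps)
  have ode: "(sin \<theta>)\<^sup>2 * poly (pderiv (pderiv P)) (cos \<theta>)
    = - (\<beta> - \<alpha> - (\<alpha> + \<beta> + 2) * cos \<theta>) * poly (pderiv P) (cos \<theta>)
      - real n * (real n + \<alpha> + \<beta> + 1) * poly P (cos \<theta>)"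
  proof -
    have "(1 - x * x) * poly (pderiv (pderiv P)) x
      = - (\<beta> - \<alpha> - (\<alpha> + \<beta> + 2) * x) * poly (pderiv P) x - real n * (real n + \<alpha> + \<beta> + 1) * poly P x" for x
    proof -
      have 1: "poly [:1, 0, -1:] x = 1 - x * x" "poly [:\<beta> - \<alpha>, - (\<alpha> + \<beta> + 2):] x = \<beta> - \<alpha> - (\<alpha> + \<beta> + 2) * x"
        by (simp_all add: algebra_simps)
      have "X = - b * y - l * z" if "X + b * y = - l * z" for X b y l z :: real
        using that by simp
      from this[OF arg_cong[OF jacobi_poly_ode[of \<alpha> \<beta> n], of "\<lambda>p. poly p x",
            unfolded poly_add poly_mult poly_smult 1]]
      show ?thesis unfolding P_def .
    qed
    then show ?thesis by (simp only: sin_squared_eq power2_eq_square[of "cos \<theta>"])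
  qed
  have ks: "2 * k \<theta> * sin \<theta> = (\<alpha> - \<beta>) + (\<alpha> + \<beta> + 1) * cos \<theta>"
    unfolding k_def using s by simp
  have "((\<lambda>\<theta>. g \<theta> * (k \<theta> * poly P (cos \<theta>) - sin \<theta> * poly (pderiv P) (cos \<theta>))) has_real_derivative
      g \<theta> * k \<theta> * (k \<theta> * poly P (cos \<theta>) - sin \<theta> * poly (pderiv P) (cos \<theta>))
      + (k' \<theta> * poly P (cos \<theta>) + - sin \<theta> * poly (pderiv P) (cos \<theta>) * k \<theta>
        - (cos \<theta> * poly (pderiv P) (cos \<theta>) + - sin \<theta> * poly (pderiv (pderiv P)) (cos \<theta>) * sin \<theta>)) * g \<theta>) (at \<theta>)"
    by (intro DERIV_mult DERIV_diff dg dk dP DERIV_sin)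
  also have "g \<theta> * k \<theta> * (k \<theta> * poly P (cos \<theta>) - sin \<theta> * poly (pderiv P) (cos \<theta>))
      + (k' \<theta> * poly P (cos \<theta>) + - sin \<theta> * poly (pderiv P) (cos \<theta>) * k \<theta>
        - (cos \<theta> * poly (pderiv P) (cos \<theta>) + - sin \<theta> * poly (pderiv (pderiv P)) (cos \<theta>) * sin \<theta>)) * g \<theta>
      = g \<theta> * (((k \<theta>)\<^sup>2 + k' \<theta>) * poly P (cos \<theta>) - (2 * k \<theta> * sin \<theta> + cos \<theta>) * poly (pderiv P) (cos \<theta>)
        + (sin \<theta>)\<^sup>2 * poly (pderiv (pderiv P)) (cos \<theta>))"
    by (simp add: power2_eq_square algebra_simps)
  also have "\<dots> = - (real n * (real n + \<alpha> + \<beta> + 1) + - ((k \<theta>)\<^sup>2 + k' \<theta>)) * (g \<theta> * poly P (cos \<theta>))"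
    unfolding ode ks by (simp add: algebra_simps)
  finally show ?th2 .
qed

text \<open>The potential of the Liouville normal form is free of n, and the factor g lies between
  positive constants on the compact interval, so the bound for oscillators carries over with a
  constant independent of n.\<close>

lemma jacobi_poly_sup_le:
  fixes \<alpha> \<beta> :: real and E :: "real set"
  assumes sum: "\<alpha> + \<beta> > -1" and ab: "0 < a" "b < pi"
    and E: "E \<in> lmeasurable" "E \<subseteq> {a..b}" and pos: "measure lebesgue E > 0"
  obtains C n0 where "\<And>n K \<theta>. \<lbrakk>n \<ge> n0; \<And>\<theta>. \<theta> \<in> E \<Longrightarrow> \<bar>poly (jacobi_poly \<alpha> \<beta> n) (cos \<theta>)\<bar> \<le> K; \<theta> \<in> {a..b}\<rbrakk>
    \<Longrightarrow> \<bar>poly (jacobi_poly \<alpha> \<beta> n) (cos \<theta>)\<bar> \<le> C * K"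
proof -
  define g where "g \<theta> = exp ((\<alpha> + 1 / 2) / 2 * ln (1 - cos \<theta>) + (\<beta> + 1 / 2) / 2 * ln (1 + cos \<theta>))" for \<theta> :: real
  define k where "k \<theta> = ((\<alpha> - \<beta>) + (\<alpha> + \<beta> + 1) * cos \<theta>) / (2 * sin \<theta>)" for \<theta> :: real
  define k' where "k' \<theta> = - ((\<alpha> + \<beta> + 1) + (\<alpha> - \<beta>) * cos \<theta>) / (2 * (sin \<theta>)\<^sup>2)" for \<theta> :: real
  obtain \<theta>0 where \<theta>0: "\<theta>0 \<in> E" using pos by fastforce
  then have ne: "{a..b} \<noteq> {}" using E by auto
  have sn: "sin \<theta> > 0" if "\<theta> \<in> {a..b}" for \<theta> using that ab by (intro sin_gt_zero) auto
  have cg: "continuous_on {a..b} g"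
  proof (rule continuous_at_imp_continuous_on, rule ballI)
    fix \<theta> assume "\<theta> \<in> {a..b}"
    then have c: "1 - cos \<theta> \<noteq> 0" "1 + cos \<theta> \<noteq> 0"
      using sn[of \<theta>] sin_cos_squared_add[of \<theta>] by (auto simp: power2_eq_square add_eq_0_iff)
    show "isCont g \<theta>" unfolding g_def by (intro continuous_intros c)
  qed
  have gpos: "g \<theta> > 0" for \<theta> by (simp add: g_def)
  obtain \<theta>1 where \<theta>1: "\<And>\<theta>. \<theta> \<in> {a..b} \<Longrightarrow> g \<theta> \<le> g \<theta>1"
    using continuous_attains_sup[OF compact_Icc ne cg] by blast
  obtain \<theta>2 where \<theta>2: "\<And>\<theta>. \<theta> \<in> {a..b} \<Longrightarrow> g \<theta>2 \<le> g \<theta>"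
    using continuous_attains_inf[OF compact_Icc ne cg] by blast
  have "continuous_on {a..b} (\<lambda>\<theta>. - ((k \<theta>)\<^sup>2 + k' \<theta>))"
    unfolding k_def k'_def using sn by (intro continuous_intros) (fastforce dest: less_imp_neq)+
  then have "bounded ((\<lambda>\<theta>. - ((k \<theta>)\<^sup>2 + k' \<theta>)) ` {a..b})"
    by (intro compact_imp_bounded compact_continuous_image) auto
  then obtain Q where "\<forall>y\<in>(\<lambda>\<theta>. - ((k \<theta>)\<^sup>2 + k' \<theta>)) ` {a..b}. norm y \<le> Q" unfolding bounded_iff by blast
  then have Q: "\<bar>- ((k \<theta>)\<^sup>2 + k' \<theta>)\<bar> \<le> Q" if "\<theta> \<in> {a..b}" for \<theta> using that by auto
  obtain N0 where N0: "\<And>N u w q K \<theta>. \<lbrakk>N \<ge> N0;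
      \<And>\<theta>. \<theta> \<in> {a..b} \<Longrightarrow> (u has_real_derivative w \<theta>) (at \<theta>);
      \<And>\<theta>. \<theta> \<in> {a..b} \<Longrightarrow> (w has_real_derivative - (N\<^sup>2 + q \<theta>) * u \<theta>) (at \<theta>);
      \<And>\<theta>. \<theta> \<in> {a..b} \<Longrightarrow> \<bar>q \<theta>\<bar> \<le> Q;
      \<And>\<theta>. \<theta> \<in> E \<Longrightarrow> \<bar>u \<theta>\<bar> \<le> K; \<theta> \<in> {a..b}\<rbrakk> \<Longrightarrow> \<bar>u \<theta>\<bar> \<le> 8 * K"
    using oscillator_sup_le[OF E pos, of Q] by blast
  show thesis
  proof (rule that[of "nat \<lceil>\<bar>N0\<bar>\<rceil>" "8 * g \<theta>1 / g \<theta>2"])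
    fix n K \<theta>
    assume n: "nat \<lceil>\<bar>N0\<bar>\<rceil> \<le> n" and K: "\<And>\<theta>. \<theta> \<in> E \<Longrightarrow> \<bar>poly (jacobi_poly \<alpha> \<beta> n) (cos \<theta>)\<bar> \<le> K"
      and \<theta>: "\<theta> \<in> {a..b}"
    let ?P = "jacobi_poly \<alpha> \<beta> n"
    \<comment> \<open>The frequency is the root of the whole eigenvalue, so that no n is left in the
      perturbation q. It is at least n, as \<alpha> + \<beta> + 1 is positive.\<close>
    define N where "N = sqrt (real n * (real n + \<alpha> + \<beta> + 1))"
    have NN: "N\<^sup>2 = real n * (real n + \<alpha> + \<beta> + 1)" using sum by (simp add: N_def)
    have "\<bar>N0\<bar> \<le> real n" using n by linarith
    also have "real n \<le> N"
      unfolding N_def using sum by (intro real_le_rsqrt) (auto simp: power2_eq_square intro!: mult_left_mono)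
    finally have N: "N0 \<le> N" by simp
    have "\<bar>g \<theta> * poly ?P (cos \<theta>)\<bar> \<le> 8 * (g \<theta>1 * K)"
    proof (rule N0[where q = "\<lambda>\<theta>. - ((k \<theta>)\<^sup>2 + k' \<theta>)", OF N _ _ Q _ \<theta>])
      fix t assume "t \<in> {a..b}"
      then have t: "0 < t" "t < pi" using ab by auto
      show "((\<lambda>\<theta>. g \<theta> * poly ?P (cos \<theta>)) has_real_derivative
          g t * (k t * poly ?P (cos t) - sin t * poly (pderiv ?P) (cos t))) (at t)"
        unfolding g_def k_def by (rule jacobi_liouville(1)[OF t])
      show "((\<lambda>\<theta>. g \<theta> * (k \<theta> * poly ?P (cos \<theta>) - sin \<theta> * poly (pderiv ?P) (cos \<theta>))) has_real_derivative
          - (N\<^sup>2 + - ((k t)\<^sup>2 + k' t)) * (g t * poly ?P (cos t))) (at t)"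
        unfolding g_def k_def k'_def NN by (rule jacobi_liouville(2)[OF t])
    next
      fix t assume t: "t \<in> E"
      have "g t * \<bar>poly ?P (cos t)\<bar> \<le> g \<theta>1 * K"
        using \<theta>1[of t] K[OF t] t E gpos[of \<theta>1] by (intro mult_mono) auto
      then show "\<bar>g t * poly ?P (cos t)\<bar> \<le> g \<theta>1 * K" using gpos[of t] by (simp add: abs_mult)
    qed
    moreover have "g \<theta>2 * \<bar>poly ?P (cos \<theta>)\<bar> \<le> g \<theta> * \<bar>poly ?P (cos \<theta>)\<bar>"
      using \<theta>2[OF \<theta>] by (rule mult_right_mono) simp
    ultimately show "\<bar>poly ?P (cos \<theta>)\<bar> \<le> 8 * g \<theta>1 / g \<theta>2 * K"
      using gpos[of \<theta>] gpos[of \<theta>2] by (simp add: abs_mult field_simps)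
  qed
qed

section \<open>A lower bound away from the endpoints\<close>

lemma jacobi_norm_sq_pos:
  fixes \<alpha> \<beta> :: real
  assumes ab: "\<alpha> > -1" "\<beta> > -1" and sum: "\<alpha> + \<beta> > -1"
  shows "jacobi_norm_sq \<alpha> \<beta> n > 0"
  unfolding jacobi_norm_sq_eq[OF ab sum] using ab sum
  by (intro divide_pos_pos mult_pos_pos Gamma_real_pos) auto

lemma space_jacobi_measure [simp]: "space (jacobi_measure \<alpha> \<beta>) = {-1..1}"
  by (simp add: jacobi_measure_def space_restrict_space)

lemma borel_measurable_jacobi_measure:
  "f \<in> borel_measurable borel \<Longrightarrow> f \<in> borel_measurable (jacobi_measure \<alpha> \<beta>)"
  by (auto simp: jacobi_measure_def intro!: measurable_restrict_space1)

text \<open>For large n the integral of (1 - x^2) times the squared polynomial is at least h/4, h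
  being its squared norm. Where \<bar>x\<bar> exceeds 15/16 the factor 1 - x^2 is at most (1/16) 2 =
  1/8, so that region yields at most h/8. If the square stayed below c h inside, the rest would
  yield at most h/16, too little in total.\<close>

lemma jacobi_poly_large_inside:
  fixes \<alpha> \<beta> :: real
  assumes ab: "\<alpha> > -1" "\<beta> > -1" and sum: "\<alpha> + \<beta> > -1"
  obtains c n0 where "c > 0"
    "\<And>n. n \<ge> n0 \<Longrightarrow> \<exists>x\<in>{- (15 / 16)..15 / 16}. c * jacobi_norm_sq \<alpha> \<beta> n \<le> (poly (jacobi_poly \<alpha> \<beta> n) x)\<^sup>2"
proof -
  let ?M = "jacobi_measure \<alpha> \<beta>"
  obtain C where C: "\<And>n. (2 * (real n * (real n + \<alpha> + \<beta> + 1)) - C) * jacobi_norm_sq \<alpha> \<beta> n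
    \<le> 4 * (real n * (real n + \<alpha> + \<beta> + 1))
        * (LINT x|jacobi_measure \<alpha> \<beta>. poly ([:1, 0, -1:] * (jacobi_poly \<alpha> \<beta> n)\<^sup>2) x)"
    using jacobi_poly_mass[OF assms] by blast
  define \<mu>0 where "\<mu>0 = (LINT x|?M. poly 1 x)"
  have \<mu>0: "\<mu>0 \<ge> 0" unfolding \<mu>0_def by (rule integral_nonneg_AE) simp
  define c where "c = 1 / (16 * (\<mu>0 + 1))"
  have c: "c > 0" "c * \<mu>0 \<le> 1 / 16" using \<mu>0 by (auto simp: c_def field_simps)
  show thesis
  proof (rule that[of c "nat \<lceil>\<bar>C\<bar>\<rceil> + 1"])
    fix n assume n: "n \<ge> nat \<lceil>\<bar>C\<bar>\<rceil> + 1"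
    let ?P = "jacobi_poly \<alpha> \<beta> n"
    define h where "h = jacobi_norm_sq \<alpha> \<beta> n"
    have h: "h > 0" unfolding h_def by (rule jacobi_norm_sq_pos[OF assms])
    define lam where "lam = real n * (real n + \<alpha> + \<beta> + 1)"
    \<comment> \<open>Such n have eigenvalue at least \<open>C\<close>, so that 2 \<open>lam\<close>
      - \<open>C\<close> is at least \<open>lam\<close>.\<close>
    have "real n \<ge> \<bar>C\<bar> + 1" "real n \<ge> 1" using n by linarith+
    then have "1 * real n \<le> (real n + \<alpha> + \<beta> + 1) * real n" using sum by (intro mult_right_mono) auto
    then have lam: "lam \<ge> C" "lam > 0" using \<open>real n \<ge> \<bar>C\<bar> + 1\<close> by (auto simp: lam_def mult.commute)
    define I where "I = (LINT x|?M. poly ([:1, 0, -1:] * ?P\<^sup>2) x)"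
    have "lam * h \<le> (2 * lam - C) * h" using lam h by (intro mult_right_mono) auto
    also have "\<dots> \<le> 4 * lam * I" using C[of n] by (simp only: lam_def h_def I_def)
    also have "4 * lam * I = lam * (4 * I)" by simp
    finally have low: "h \<le> 4 * I" using lam by simp
    show "\<exists>x\<in>{- (15 / 16)..15 / 16}. c * jacobi_norm_sq \<alpha> \<beta> n \<le> (poly ?P x)\<^sup>2"
    proof (rule ccontr)
      assume neg: "\<not> ?thesis"
      have int: "integrable ?M (poly p)" for p by (rule jacobi_measure_poly_integrable[OF ab])
      have "I \<le> (LINT x|?M. 1 / 8 * poly (?P\<^sup>2) x + c * h * poly 1 x)"
        unfolding I_def
      proof (rule integral_mono)
        fix x assume "x \<in> space ?M"
        then have x: "-1 \<le> x" "x \<le> 1" by auto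
        show "poly ([:1, 0, -1:] * ?P\<^sup>2) x \<le> 1 / 8 * poly (?P\<^sup>2) x + c * h * poly 1 x"
        proof (cases "\<bar>x\<bar> \<le> 15 / 16")
          case True
          then have "x \<in> {- (15 / 16)..15 / 16}" by (auto simp: abs_le_iff)
          then have "\<not> c * h \<le> (poly ?P x)\<^sup>2" using neg unfolding h_def by blast
          then have "(poly ?P x)\<^sup>2 \<le> c * h" by simp
          moreover have "x * x * (poly ?P x)\<^sup>2 \<ge> 0" by (rule mult_nonneg_nonneg) auto
          moreover have "1 / 8 * (poly ?P x)\<^sup>2 \<ge> 0" by simp
          ultimately have "(poly ?P x)\<^sup>2 \<le> c * h + (x * x * (poly ?P x)\<^sup>2 + 1 / 8 * (poly ?P x)\<^sup>2)"
            by linarith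
          then show ?thesis by (simp add: algebra_simps)
        next
          case False
          have "(1 - \<bar>x\<bar>) * (1 + \<bar>x\<bar>) \<le> 1 / 16 * 2" using x False by (intro mult_mono) auto
          then have "1 - x * x \<le> 1 / 8" by (simp add: algebra_simps flip: abs_mult)
          then have "(1 - x * x) * (poly ?P x)\<^sup>2 \<le> 1 / 8 * (poly ?P x)\<^sup>2" by (rule mult_right_mono) simp
          moreover have "c * h \<ge> 0" using c h by simp
          ultimately show ?thesis by (simp add: algebra_simps)
        qed
      qed (intro Bochner_Integration.integrable_add integrable_mult_right int)+
      also have "\<dots> = 1 / 8 * h + c * h * \<mu>0"
        unfolding \<mu>0_def h_def jacobi_norm_sq_eq_poly
        by (subst Bochner_Integration.integral_add)
           (intro integrable_mult_right int | simp only: integral_mult_right_zero)+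
      also have "c * h * \<mu>0 \<le> 1 / 16 * h"
        using mult_right_mono[OF c(2), of h] h by (simp add: mult_ac)
      finally show False using low h by simp
    qed
  qed (use c in auto)
qed

subsection \<open>The divergent expansion\<close>

lemma jacobi_norm_sq_le:
  fixes \<alpha> \<beta> :: real
  assumes ab: "\<alpha> > -1" "\<beta> > -1" and sum: "\<alpha> + \<beta> > -1"
  obtains C where "C > 0" "\<And>n. n \<ge> 1 \<Longrightarrow> jacobi_norm_sq \<alpha> \<beta> n \<le> C / real n"
proof -
  define g where "g z n = Gamma (real n + z) / (fact (n - 1) * real n powr z)" for z n
  have lim: "g z \<longlonglongrightarrow> 1" if "z > 0" for z unfolding g_def using that by (rule Gamma_shift_tendsto)
  have "(\<lambda>n. g (\<alpha> + 1) n * g (\<beta> + 1) n / g (\<alpha> + \<beta> + 1) n) \<longlonglongrightarrow> 1 * 1 / 1"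
    using ab sum by (intro tendsto_intros lim) auto
  then obtain B where B: "\<And>n. \<bar>g (\<alpha> + 1) n * g (\<beta> + 1) n / g (\<alpha> + \<beta> + 1) n\<bar> \<le> B"
    using LIMSEQ_bounded_real by blast
  have B0: "B \<ge> 0" using B[of 0] by linarith
  let ?K = "2 powr (\<alpha> + \<beta> + 1)"
  have "jacobi_norm_sq \<alpha> \<beta> n \<le> (?K * B + 1) / real n" if n: "n \<ge> 1" for n
  proof -
    have G: "Gamma (real n + z) = g z n * (fact (n - 1) * real n powr z)" for z
      using n by (simp add: g_def)
    have f: "(fact n :: real) = real n * fact (n - 1)" using n by (simp add: fact_reduce)
    have pw: "real n powr (\<alpha> + 1) * real n powr (\<beta> + 1) = real n powr (\<alpha> + \<beta> + 1) * real n"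
      using n by (simp flip: powr_add add: powr_mult_base mult.commute add_ac)
    have d: "2 * real n + \<alpha> + \<beta> + 1 \<ge> real n" using sum by simp
    have "jacobi_norm_sq \<alpha> \<beta> n = ?K * (g (\<alpha> + 1) n * (fact (n - 1) * real n powr (\<alpha> + 1)))
        * (g (\<beta> + 1) n * (fact (n - 1) * real n powr (\<beta> + 1)))
        / ((2 * real n + \<alpha> + \<beta> + 1) * (real n * fact (n - 1)) * (g (\<alpha> + \<beta> + 1) n * (fact (n - 1) * real n powr (\<alpha> + \<beta> + 1))))"
      unfolding jacobi_norm_sq_eq[OF ab sum] G[symmetric] f[symmetric] by (simp add: add_ac)
    also have "\<dots> = ?K * (g (\<alpha> + 1) n * g (\<beta> + 1) n / g (\<alpha> + \<beta> + 1) n)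
        * (real n powr (\<alpha> + 1) * real n powr (\<beta> + 1)) / ((2 * real n + \<alpha> + \<beta> + 1) * real n * real n powr (\<alpha> + \<beta> + 1))"
      by (simp add: mult_ac)
    also have "\<dots> = ?K * (g (\<alpha> + 1) n * g (\<beta> + 1) n / g (\<alpha> + \<beta> + 1) n) / (2 * real n + \<alpha> + \<beta> + 1)"
      unfolding pw using n by simp
    also have "\<dots> \<le> ?K * B / (2 * real n + \<alpha> + \<beta> + 1)"
      using B[of n, THEN abs_le_D1] d n by (intro divide_right_mono mult_left_mono) auto
    also have "\<dots> \<le> ?K * B / real n" using d n B0 by (intro divide_left_mono) auto
    also have "\<dots> \<le> (?K * B + 1) / real n" by (intro divide_right_mono) auto
    finally show ?thesis .
  qed
  moreover have "?K * B + 1 > 0" using B0 by (intro add_nonneg_pos) auto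
  ultimately show thesis by (intro that)
qed

text \<open>For s = - \<gamma> the Pochhammer symbol of the explicit integral has the positive base
  \<gamma>, so there is no cancellation. The exponents add up to \<gamma> + (\<beta> + 1) - 1 -
  (\<alpha> + \<beta> - \<gamma> + 2) = 2 \<gamma> - \<alpha> - 2.\<close>

lemma jacobi_coeff_powr_ge:
  fixes \<alpha> \<beta> \<gamma> :: real
  assumes ab: "\<alpha> > -1" "\<beta> > -1" and g: "0 < \<gamma>" "\<gamma> < \<alpha> + 1"
  obtains \<kappa> where "\<kappa> > 0"
    "eventually (\<lambda>n. \<kappa> * real n powr (2 * \<gamma> - \<alpha> - 2)
      \<le> jacobi_coeff \<alpha> \<beta> (\<lambda>x. (1 - x) powr (- \<gamma>)) n) sequentially"
proof -
  define g where "g z n = Gamma (real n + z) / (fact (n - 1) * real n powr z)" for z n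
  have lim: "g z \<longlonglongrightarrow> 1" if "z > 0" for z unfolding g_def using that by (rule Gamma_shift_tendsto)
  define z where "z = \<alpha> + \<beta> - \<gamma> + 2"
  have z: "z > 0" using ab g by (simp add: z_def)
  have "(\<lambda>n. g \<gamma> n * g (\<beta> + 1) n / g z n) \<longlonglongrightarrow> 1 * 1 / 1"
    using ab z \<open>0 < \<gamma>\<close> by (intro tendsto_intros lim) auto
  then have ev: "eventually (\<lambda>n. 1 / 2 < g \<gamma> n * g (\<beta> + 1) n / g z n) sequentially"
    by (rule order_tendstoD(1)) simp
  define K where "K = 2 powr (\<alpha> + \<beta> + - \<gamma> + 1) * Gamma (\<alpha> + - \<gamma> + 1) / Gamma \<gamma>"
  have K: "K > 0" unfolding K_def using g by (intro divide_pos_pos mult_pos_pos Gamma_real_pos) auto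
  show thesis
  proof (rule that[of "K / 2"])
    show "eventually (\<lambda>n. K / 2 * real n powr (2 * \<gamma> - \<alpha> - 2)
      \<le> jacobi_coeff \<alpha> \<beta> (\<lambda>x. (1 - x) powr (- \<gamma>)) n) sequentially"
      using ev eventually_ge_at_top[of 1]
    proof eventually_elim
      case (elim n)
      have G: "Gamma (real n + z) = g z n * (fact (n - 1) * real n powr z)" for z
        using elim by (simp add: g_def)
      have f: "(fact n :: real) = real n * fact (n - 1)" using elim by (simp add: fact_reduce)
      have p: "pochhammer \<gamma> n = Gamma (real n + \<gamma>) / Gamma \<gamma>"
        using pochhammer_Gamma[OF pos_not_nonpos_Int[OF \<open>0 < \<gamma>\<close>], of n] by (simp add: add.commute)
      have "jacobi_coeff \<alpha> \<beta> (\<lambda>x. (1 - x) powr (- \<gamma>)) n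
        = 2 powr (\<alpha> + \<beta> + - \<gamma> + 1) * Gamma (\<alpha> + - \<gamma> + 1) * pochhammer (- (- \<gamma>)) n
          * Gamma (real n + \<beta> + 1) / (fact n * Gamma (\<alpha> + \<beta> + - \<gamma> + real n + 2))"
        unfolding jacobi_coeff_def using ab g
        by (intro has_bochner_integral_integral_eq jacobi_poly_powr_integral) auto
      also have "\<dots> = K * (Gamma (real n + \<gamma>) * Gamma (real n + (\<beta> + 1)) / (fact n * Gamma (real n + z)))"
      proof -
        have z_eq: "\<alpha> + \<beta> + - \<gamma> + real n + 2 = real n + z" by (simp add: z_def)
        show ?thesis unfolding z_eq minus_minus p K_def by (simp add: add.assoc)
      qed
      also have "\<dots> = K * (g \<gamma> n * g (\<beta> + 1) n / g z n) * (real n powr \<gamma> * real n powr (\<beta> + 1) / (real n * real n powr z))"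
        unfolding G f by (simp add: mult_ac)
      also have "real n powr \<gamma> * real n powr (\<beta> + 1) / (real n * real n powr z) = real n powr (2 * \<gamma> - \<alpha> - 2)"
      proof -
        have "real n powr \<gamma> * real n powr (\<beta> + 1) / (real n powr 1 * real n powr z) = real n powr (\<gamma> + (\<beta> + 1) - (1 + z))"
          by (simp only: powr_add powr_diff)
        then show ?thesis using elim by (simp add: z_def algebra_simps)
      qed
      also have "K * (g \<gamma> n * g (\<beta> + 1) n / g z n) * real n powr (2 * \<gamma> - \<alpha> - 2)
          \<ge> K * (1 / 2) * real n powr (2 * \<gamma> - \<alpha> - 2)"
        using elim K by (intro mult_right_mono mult_left_mono) auto
      finally show ?case by simp
    qed
  qed (use K in auto)
qed

lemma jacobi_coeff_bounded_le:
  fixes \<alpha> \<beta> :: real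
  assumes ab: "\<alpha> > -1" "\<beta> > -1" and sum: "\<alpha> + \<beta> > -1"
    and f: "f \<in> borel_measurable borel" "\<And>x. x \<in> {-1..1} \<Longrightarrow> \<bar>f x\<bar> \<le> 1"
  shows "integrable (jacobi_measure \<alpha> \<beta>) (\<lambda>x. f x * poly (jacobi_poly \<alpha> \<beta> n) x)"
    and "\<bar>jacobi_coeff \<alpha> \<beta> f n\<bar>
      \<le> (1 + (LINT x|jacobi_measure \<alpha> \<beta>. poly 1 x)) / 2 * sqrt (jacobi_norm_sq \<alpha> \<beta> n)"
proof -
  let ?M = "jacobi_measure \<alpha> \<beta>" and ?P = "jacobi_poly \<alpha> \<beta> n"
  define h where "h = jacobi_norm_sq \<alpha> \<beta> n"
  define t where "t = sqrt h"
  have t: "t > 0" "t * t = h" unfolding t_def h_def using jacobi_norm_sq_pos[OF ab sum, of n] by auto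
  have int: "integrable ?M (poly p)" for p by (rule jacobi_measure_poly_integrable[OF ab])
  have le: "\<bar>f x * poly ?P x\<bar> \<le> \<bar>poly ?P x\<bar>" if "x \<in> {-1..1}" for x
    using f(2)[OF that] by (simp add: abs_mult mult_left_le_one_le)
  show fP: "integrable ?M (\<lambda>x. f x * poly ?P x)"
  proof (rule Bochner_Integration.integrable_bound[OF int[of ?P]])
    show "(\<lambda>x. f x * poly ?P x) \<in> borel_measurable ?M"
      by (intro borel_measurable_jacobi_measure borel_measurable_times f(1) borel_measurable_poly)
    show "AE x in ?M. norm (f x * poly ?P x) \<le> norm (poly ?P x)"
      using le by (intro AE_I2) (simp add: abs_mult)
  qed
  have "\<bar>jacobi_coeff \<alpha> \<beta> f n\<bar> \<le> (LINT x|?M. \<bar>f x * poly ?P x\<bar>)"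
    unfolding jacobi_coeff_def by (rule integral_abs_bound)
  also have "\<dots> \<le> (LINT x|?M. 1 / (2 * t) * poly (?P\<^sup>2) x + t / 2 * poly 1 x)"
  proof (rule integral_mono)
    fix x assume "x \<in> space ?M"
    then have "\<bar>f x * poly ?P x\<bar> \<le> \<bar>poly ?P x\<bar>" by (intro le) auto
    \<comment> \<open>The inequality between the two means stands in for Cauchy-Schwarz; t = sqrt h
      balances the two parts after integration.\<close>
    also have "\<dots> \<le> 1 / (2 * t) * poly (?P\<^sup>2) x + t / 2 * poly 1 x"
      using t(1) zero_le_power2[of "\<bar>poly ?P x\<bar> - t"] by (simp add: field_simps power2_eq_square)
    finally show "\<bar>f x * poly ?P x\<bar> \<le> 1 / (2 * t) * poly (?P\<^sup>2) x + t / 2 * poly 1 x" .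
  qed (intro Bochner_Integration.integrable_add integrable_mult_right int integrable_abs fP)+
  also have "\<dots> = 1 / (2 * t) * h + t / 2 * (LINT x|?M. poly 1 x)"
    unfolding h_def jacobi_norm_sq_eq_poly
    by (subst Bochner_Integration.integral_add)
       (intro integrable_mult_right int | simp only: integral_mult_right_zero)+
  also have "\<dots> = (1 + (LINT x|?M. poly 1 x)) / 2 * t"
    unfolding t(2)[symmetric] using t(1) by (simp add: field_simps)
  finally show "\<bar>jacobi_coeff \<alpha> \<beta> f n\<bar> \<le> (1 + (LINT x|?M. poly 1 x)) / 2 * sqrt (jacobi_norm_sq \<alpha> \<beta> n)"
    by (simp add: t_def h_def)
qed

section \<open>The cut-off power and its coefficients\<close>

definition half_powr :: "real \<Rightarrow> real \<Rightarrow> real" where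
  "half_powr \<gamma> x = (if 0 \<le> x \<and> x < 1 then (1 - x) powr (- \<gamma>) else 0)"

lemma borel_measurable_half_powr [measurable]: "half_powr \<gamma> \<in> borel_measurable borel"
  unfolding half_powr_def by measurable

text \<open>The p-th power of the singularity lowers the exponent of the weight to \<alpha> -
  \<gamma> p, which is still above -1.\<close>

lemma half_powr_Lp:
  fixes \<alpha> \<beta> :: real
  assumes "\<beta> > -1" "\<gamma> * p < \<alpha> + 1"
  shows "half_powr \<gamma> \<in> Lp_functions p (jacobi_measure \<alpha> \<beta>)"
proof -
  let ?M = "jacobi_measure \<alpha> \<beta>"
  have "integrable (jacobi_measure (\<alpha> + - (\<gamma> * p)) \<beta>) (poly 1)"
    using assms by (intro jacobi_measure_poly_integrable) auto
  then have "has_bochner_integral (jacobi_measure (\<alpha> + - (\<gamma> * p)) \<beta>) (poly 1) (LINT x|jacobi_measure (\<alpha> + - (\<gamma> * p)) \<beta>. poly 1 x)"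
    by (rule has_bochner_integral_integrable)
  then have "integrable ?M (\<lambda>x. (1 - x) powr - (\<gamma> * p) * poly 1 x)"
    by (subst (asm) jacobi_measure_shift) (auto simp: has_bochner_integral_iff)
  moreover have "(\<lambda>x. \<bar>half_powr \<gamma> x\<bar> powr p) \<in> borel_measurable ?M"
    by (intro borel_measurable_jacobi_measure) measurable
  ultimately have "integrable ?M (\<lambda>x. \<bar>half_powr \<gamma> x\<bar> powr p)"
    by (rule Bochner_Integration.integrable_bound)
       (auto simp: half_powr_def powr_powr)
  then show ?thesis
    by (simp add: Lp_functions_def borel_measurable_jacobi_measure)
qed

lemma half_powr_coeff_large:
  fixes \<alpha> \<beta> \<gamma> \<delta> B :: real
  assumes ab: "\<alpha> > -1" "\<beta> > -1" and sum: "\<alpha> + \<beta> > -1"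
    and g: "0 < \<gamma>" "\<gamma> < \<alpha> + 1" and d: "0 \<le> \<delta>" "\<delta> < 2 * \<gamma> - \<alpha> - 3 / 2"
  shows "eventually (\<lambda>n. B * real n powr \<delta> * sqrt (jacobi_norm_sq \<alpha> \<beta> n)
    < \<bar>jacobi_coeff \<alpha> \<beta> (half_powr \<gamma>) n\<bar>) sequentially"
proof -
  let ?M = "jacobi_measure \<alpha> \<beta>" and ?P = "jacobi_poly \<alpha> \<beta>"
  define F where "F = (\<lambda>x. (1 - x) powr (- \<gamma>))"
  define G where "G x = (if x < 0 then F x else 0)" for x
  have G1: "\<bar>G x\<bar> \<le> 1" for x
  proof (cases "x < 0")
    case True
    then have "(1 - x) powr (- \<gamma>) \<le> 1" using g powr_mono[of "- \<gamma>" 0 "1 - x"] by simp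
    then show ?thesis by (simp add: G_def F_def)
  qed (simp add: G_def)
  have Gm: "G \<in> borel_measurable borel" unfolding G_def F_def by measurable
  obtain \<kappa> where \<kappa>: "\<kappa> > 0"
    "eventually (\<lambda>n. \<kappa> * real n powr (2 * \<gamma> - \<alpha> - 2) \<le> jacobi_coeff \<alpha> \<beta> F n) sequentially"
    unfolding F_def using jacobi_coeff_powr_ge[OF ab g] by blast
  obtain C where C: "C > 0" "\<And>n. n \<ge> 1 \<Longrightarrow> jacobi_norm_sq \<alpha> \<beta> n \<le> C / real n"
    using jacobi_norm_sq_le[OF ab sum] by blast
  define L where "L = (1 + (LINT x|?M. poly 1 x)) / 2"
  have L0: "L \<ge> 0" unfolding L_def by (intro divide_nonneg_pos add_nonneg_nonneg integral_nonneg_AE) auto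
  have split: "jacobi_coeff \<alpha> \<beta> (half_powr \<gamma>) n = jacobi_coeff \<alpha> \<beta> F n - jacobi_coeff \<alpha> \<beta> G n" for n
  proof -
    have "integrable ?M (\<lambda>x. F x * poly (?P n) x)"
      unfolding F_def using ab g by (intro integrable.intros[OF jacobi_poly_powr_integral]) auto
    moreover have "integrable ?M (\<lambda>x. G x * poly (?P n) x)"
      by (rule jacobi_coeff_bounded_le(1)[OF ab sum Gm G1])
    ultimately have "jacobi_coeff \<alpha> \<beta> F n - jacobi_coeff \<alpha> \<beta> G n = (LINT x|?M. F x * poly (?P n) x - G x * poly (?P n) x)"
      unfolding jacobi_coeff_def by (rule Bochner_Integration.integral_diff[symmetric])
    also have "\<dots> = jacobi_coeff \<alpha> \<beta> (half_powr \<gamma>) n"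
      unfolding jacobi_coeff_def
      \<comment> \<open>At x = 1 both sides vanish, because \<open>0 powr\<close> anything is
        0.\<close>
      by (intro Bochner_Integration.integral_cong) (auto simp: F_def G_def half_powr_def)
    finally show ?thesis ..
  qed
  \<comment> \<open>The excess of the coefficient exponent 2 \<gamma> - \<alpha> - 2 over the
    exponent \<delta> - 1/2 of the bound to be beaten.\<close>
  define \<eta> where "\<eta> = 2 * \<gamma> - \<alpha> - 3 / 2 - \<delta>"
  have \<eta>: "\<eta> > 0" using d by (simp add: \<eta>_def)
  \<comment> \<open>In the sum, \<bar>B\<bar> pays for the target, \<open>L\<close> for the bounded
    part removed by the cut-off, and 1 for strictness.\<close>
  define W where "W = (\<bar>B\<bar> + L + 1) * sqrt C / \<kappa>"
  have "eventually (\<lambda>n. W powr (1 / \<eta>) \<le> real n) sequentially"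
    using filterlim_real_sequentially by (simp add: filterlim_at_top)
  then have "eventually (\<lambda>n. W \<le> real n powr \<eta>) sequentially"
  proof eventually_elim
    case (elim n)
    have "W \<ge> 0" using L0 C \<kappa> by (simp add: W_def)
    then have "W = (W powr (1 / \<eta>)) powr \<eta>" using \<eta> by (simp add: powr_powr)
    also have "\<dots> \<le> real n powr \<eta>" using elim \<eta> by (intro powr_mono2) auto
    finally show ?case .
  qed
  then show ?thesis using \<kappa>(2) eventually_ge_at_top[of 1]
  proof eventually_elim
    case (elim n)
    define h where "h = jacobi_norm_sq \<alpha> \<beta> n"
    define N where "N = real n powr \<delta>"
    have h: "h > 0" unfolding h_def by (rule jacobi_norm_sq_pos[OF ab sum])
    have N1: "N \<ge> 1" unfolding N_def using elim d by (intro ge_one_powr_ge_zero) auto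
    have "sqrt h \<le> sqrt (C / real n)" using C(2)[of n] elim by (simp add: h_def)
    also have "\<dots> = sqrt C * real n powr (- 1 / 2)"
      using elim by (simp add: real_sqrt_divide powr_minus_divide powr_half_sqrt)
    finally have sh: "sqrt h \<le> sqrt C * real n powr (- 1 / 2)" .
    have "(\<bar>B\<bar> + L + 1) * N * sqrt h \<le> (\<bar>B\<bar> + L + 1) * N * (sqrt C * real n powr (- 1 / 2))"
      using L0 N1 by (intro mult_left_mono sh) auto
    also have "\<dots> = (\<bar>B\<bar> + L + 1) * sqrt C * (N * real n powr (- 1 / 2))" by simp
    also have "\<dots> \<le> (\<kappa> * real n powr \<eta>) * (N * real n powr (- 1 / 2))"
      using elim(1) \<kappa>(1) N1 by (intro mult_right_mono) (auto simp: W_def field_simps)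
    also have "\<dots> = \<kappa> * real n powr (\<eta> + (\<delta> + - 1 / 2))"
      unfolding N_def by (simp only: powr_add mult.assoc)
    also have "\<eta> + (\<delta> + - 1 / 2) = 2 * \<gamma> - \<alpha> - 2" by (simp add: \<eta>_def)
    also have "\<kappa> * real n powr (2 * \<gamma> - \<alpha> - 2) \<le> jacobi_coeff \<alpha> \<beta> F n" by (rule elim(2))
    finally have 1: "(\<bar>B\<bar> + L + 1) * N * sqrt h \<le> jacobi_coeff \<alpha> \<beta> F n" .
    have 2: "\<bar>jacobi_coeff \<alpha> \<beta> G n\<bar> \<le> L * sqrt h"
      unfolding L_def h_def by (rule jacobi_coeff_bounded_le(2)[OF ab sum Gm G1])
    have "L * sqrt h \<le> N * (L * sqrt h)" using N1 L0 h mult_right_mono[of 1 N "L * sqrt h"] by simp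
    moreover have "B * N * sqrt h \<le> \<bar>B\<bar> * N * sqrt h" using N1 h by (intro mult_right_mono) auto
    moreover have "N * sqrt h > 0" using N1 h by simp
    moreover have "(\<bar>B\<bar> + L + 1) * N * sqrt h = \<bar>B\<bar> * N * sqrt h + N * (L * sqrt h) + N * sqrt h"
      by (simp add: algebra_simps)
    ultimately have "B * N * sqrt h < jacobi_coeff \<alpha> \<beta> F n - \<bar>jacobi_coeff \<alpha> \<beta> G n\<bar>"
      using 1 2 by linarith
    also have "\<dots> \<le> \<bar>jacobi_coeff \<alpha> \<beta> (half_powr \<gamma>) n\<bar>" unfolding split by linarith
    finally show ?case by (simp add: N_def h_def)
  qed
qed

text \<open>A fixed bound and closed conditions make the exceptional set compact, hence measurable.
  With positive measure, smallness of \<open>P\<^sub>n\<close> on it would spread to the whole arc,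
  which is long enough for its cosines to cover [-15/16, 15/16], where \<open>P\<^sub>n\<close> is
  large.\<close>

lemma negligible_bounded_terms:
  fixes \<alpha> \<beta> \<delta> K r :: real
  assumes ab: "\<alpha> > -1" "\<beta> > -1" and sum: "\<alpha> + \<beta> > -1" and r: "0 < r" "r \<le> arccos (15 / 16)"
    and large: "\<And>B. eventually (\<lambda>n. B * real n powr \<delta> * sqrt (jacobi_norm_sq \<alpha> \<beta> n)
      < \<bar>jacobi_coeff \<alpha> \<beta> f n\<bar>) sequentially"
  shows "negligible {\<theta> \<in> {r..pi - r}. \<forall>n\<ge>1. \<bar>jacobi_term \<alpha> \<beta> f n (cos \<theta>)\<bar> \<le> K * real n powr \<delta>}"
    (is "negligible ?E")
proof (rule ccontr)
  define E where "E = ?E"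
  assume "\<not> negligible ?E"
  then have nn: "\<not> negligible E" unfolding E_def .
  let ?P = "jacobi_poly \<alpha> \<beta>"
  have "closed ({r..pi - r} \<inter> (\<Inter>n\<in>{1..}. {\<theta>. \<bar>jacobi_term \<alpha> \<beta> f n (cos \<theta>)\<bar> \<le> K * real n powr \<delta>}))"
    unfolding jacobi_term_def
    by (intro closed_Int closed_INT ballI closed_Collect_le continuous_intros) auto
  moreover have "E = {r..pi - r} \<inter> (\<Inter>n\<in>{1..}. {\<theta>. \<bar>jacobi_term \<alpha> \<beta> f n (cos \<theta>)\<bar> \<le> K * real n powr \<delta>})"
    by (auto simp: E_def)
  moreover have "bounded E" by (rule bounded_subset[of "{r..pi - r}"]) (auto simp: E_def)
  ultimately have lm: "E \<in> lmeasurable" by (auto intro!: lmeasurable_compact simp: compact_eq_bounded_closed)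
  have "measure lebesgue E \<noteq> 0" using nn negligible_iff_measure0[OF lm] by blast
  then have pos: "measure lebesgue E > 0" using measure_nonneg[of lebesgue E] by linarith
  have sub: "E \<subseteq> {r..pi - r}" by (auto simp: E_def)
  have b: "0 < r" "pi - r < pi" using r by auto
  obtain C n1 where C: "\<And>n K \<theta>. \<lbrakk>n \<ge> n1; \<And>\<theta>. \<theta> \<in> E \<Longrightarrow> \<bar>poly (?P n) (cos \<theta>)\<bar> \<le> K; \<theta> \<in> {r..pi - r}\<rbrakk>
    \<Longrightarrow> \<bar>poly (?P n) (cos \<theta>)\<bar> \<le> C * K"
  proof (rule jacobi_poly_sup_le[OF sum b lm sub pos])
    fix C n0
    assume "\<And>n K \<theta>. \<lbrakk>n \<ge> n0; \<And>\<theta>. \<theta> \<in> E \<Longrightarrow> \<bar>poly (?P n) (cos \<theta>)\<bar> \<le> K; \<theta> \<in> {r..pi - r}\<rbrakk>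
      \<Longrightarrow> \<bar>poly (?P n) (cos \<theta>)\<bar> \<le> C * K"
    then show thesis by (rule that)
  qed
  obtain c n2 where c: "c > 0"
    "\<And>n. n \<ge> n2 \<Longrightarrow> \<exists>x\<in>{- (15 / 16)..15 / 16}. c * jacobi_norm_sq \<alpha> \<beta> n \<le> (poly (?P n) x)\<^sup>2"
    using jacobi_poly_large_inside[OF ab sum] by blast
  \<comment> \<open>Made for the comparison sqrt (c h) \<le> \<bar>C K\<bar> N h / A, which solved
    for A reads A \<le> B N sqrt h.\<close>
  define B where "B = \<bar>C * K\<bar> / sqrt c"
  have "eventually (\<lambda>n. False) sequentially"
    using large[of B] eventually_ge_at_top[of n1] eventually_ge_at_top[of n2] eventually_ge_at_top[of 1]
  proof eventually_elim
    case (elim n)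
    define h where "h = jacobi_norm_sq \<alpha> \<beta> n"
    define A where "A = \<bar>jacobi_coeff \<alpha> \<beta> f n\<bar>"
    define N where "N = real n powr \<delta>"
    have h: "h > 0" unfolding h_def by (rule jacobi_norm_sq_pos[OF ab sum])
    have AB: "B * N * sqrt h < A" using elim(1) by (simp add: A_def N_def h_def)
    moreover have "B * N * sqrt h \<ge> 0" using h c by (simp add: B_def N_def)
    ultimately have A: "A > 0" by linarith
    have small: "\<bar>poly (?P n) (cos \<theta>)\<bar> \<le> K * N * h / A" if "\<theta> \<in> E" for \<theta>
    proof -
      have "A * inverse h * \<bar>poly (?P n) (cos \<theta>)\<bar> \<le> K * N"
        using that elim(4) h by (auto simp: E_def jacobi_term_def abs_mult A_def N_def h_def)
      then show ?thesis using A h by (simp add: field_simps)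
    qed
    obtain x where x: "x \<in> {- (15 / 16)..15 / 16}" "c * h \<le> (poly (?P n) x)\<^sup>2"
      using c(2)[OF elim(3)] by (auto simp: h_def)
    have "arccos x \<ge> arccos (15 / 16)" using x by (intro arccos_le_arccos) auto
    moreover have "arccos x \<le> arccos (- (15 / 16))" using x by (intro arccos_le_arccos) auto
    moreover have "arccos (- (15 / 16)) = pi - arccos (15 / 16)" by (rule arccos_minus) auto
    ultimately have "arccos x \<in> {r..pi - r}" using r by auto
    from C[OF elim(2) small this]
    have "\<bar>poly (?P n) x\<bar> \<le> C * (K * N * h / A)" using x(1) by simp
    also have "\<dots> \<le> \<bar>C * K\<bar> * N * h / A"
    proof -
      have "C * K * (N * h / A) \<le> \<bar>C * K\<bar> * (N * h / A)"
        using h A by (intro mult_right_mono) (auto simp: N_def)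
      then show ?thesis by (simp add: mult_ac)
    qed
    finally have "\<bar>poly (?P n) x\<bar> \<le> \<bar>C * K\<bar> * N * h / A" .
    moreover have "sqrt (c * h) \<le> \<bar>poly (?P n) x\<bar>" using real_sqrt_le_mono[OF x(2)] by simp
    ultimately have "sqrt c * sqrt h \<le> \<bar>C * K\<bar> * N * h / A" by (simp add: real_sqrt_mult)
    then have "sqrt c * sqrt h * A \<le> \<bar>C * K\<bar> * N * h" using A by (simp add: pos_le_divide_eq)
    also have "\<dots> = \<bar>C * K\<bar> * N * (sqrt h * sqrt h)" using h by simp
    finally have "sqrt h * (sqrt c * A) \<le> sqrt h * (\<bar>C * K\<bar> * N * sqrt h)" by (simp only: mult_ac)
    then have "sqrt c * A \<le> \<bar>C * K\<bar> * N * sqrt h" using h by (subst (asm) mult_le_cancel_left_pos) auto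
    then have "A \<le> B * N * sqrt h" using c by (simp add: B_def field_simps)
    then show ?case using AB by simp
  qed
  then show False by simp
qed

lemma AE_unbounded_terms:
  fixes \<alpha> \<beta> \<delta> :: real
  assumes ab: "\<alpha> > -1" "\<beta> > -1" and sum: "\<alpha> + \<beta> > -1"
    and large: "\<And>B. eventually (\<lambda>n. B * real n powr \<delta> * sqrt (jacobi_norm_sq \<alpha> \<beta> n)
      < \<bar>jacobi_coeff \<alpha> \<beta> f n\<bar>) sequentially"
  shows "AE x\<in>{-1..1} in lborel. \<not> (\<exists>C. \<forall>n\<ge>1. \<bar>jacobi_term \<alpha> \<beta> f n x\<bar> \<le> C * real n powr \<delta>)"
proof -
  define E where "E r K = {\<theta> \<in> {r..pi - r}. \<forall>n\<ge>1. \<bar>jacobi_term \<alpha> \<beta> f n (cos \<theta>)\<bar> \<le> K * real n powr \<delta>}" for r K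
  define s where "s = arccos (15 / 16)"
  have s: "s > 0" using arccos_less_arccos[of "15 / 16" 1] by (simp add: s_def)
  \<comment> \<open>Countably many margins and integer bounds exhaust the open interval and all
    possible constants. The endpoints lie in no arc with a positive margin and are added by hand;
    the smooth map \<open>cos\<close> carries null sets to null sets.\<close>
  define S where "S = {-1, 1} \<union> (\<Union>m. \<Union>K. cos ` E (s / real (Suc m)) (real (K::nat)))"
  have "negligible (cos ` E (s / real (Suc m)) (real K))" for m K
  proof (rule negligible_differentiable_image_negligible)
    have "s / real (Suc m) \<le> s / 1" using s by (intro divide_left_mono) auto
    then show "negligible (E (s / real (Suc m)) (real K))"
      unfolding E_def using s by (intro negligible_bounded_terms ab sum large) (auto simp: s_def)
    show "cos differentiable_on E (s / real (Suc m)) (real K)"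
      by (auto simp: differentiable_on_def intro!: differentiable_at_withinI differentiableI derivative_intros
          DERIV_cos[THEN has_field_derivative_imp_has_derivative])
  qed auto
  then have "negligible S"
    unfolding S_def by (intro negligible_Un negligible_Union_nat) (auto simp: negligible_insert)
  then have "AE x in lebesgue. x \<notin> S"
    by (intro AE_not_in) (simp add: negligible_iff_null_sets)
  then have "AE x in lborel. x \<notin> S" by (simp add: AE_completion_iff)
  then show ?thesis
  proof eventually_elim
    case (elim x)
    show ?case
    proof (intro impI notI)
      assume x: "x \<in> {-1..1}" and "\<exists>C. \<forall>n\<ge>1. \<bar>jacobi_term \<alpha> \<beta> f n x\<bar> \<le> C * real n powr \<delta>"
      then obtain C where C: "\<And>n. n \<ge> 1 \<Longrightarrow> \<bar>jacobi_term \<alpha> \<beta> f n x\<bar> \<le> C * real n powr \<delta>" by blast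
      define \<theta> where "\<theta> = arccos x"
      have x1: "-1 < x" "x < 1" using x elim by (auto simp: S_def less_le)
      have \<theta>: "0 < \<theta>" "\<theta> < pi" "cos \<theta> = x"
        using arccos_lt_bounded[OF x1] x1 by (auto simp: \<theta>_def)
      define l where "l = min \<theta> (pi - \<theta>)"
      have l: "l > 0" "l \<le> \<theta>" "l \<le> pi - \<theta>" using \<theta> by (auto simp: l_def)
      obtain m where "s / l < real m" using reals_Archimedean2 by blast
      then have "s < real m * l" using l by (simp add: pos_divide_less_eq)
      also have "\<dots> \<le> real (Suc m) * l" using l by (intro mult_right_mono) auto
      finally have "s / real (Suc m) \<le> l" by (simp add: pos_divide_le_eq mult.commute)
      then have "\<theta> \<in> {s / real (Suc m)..pi - s / real (Suc m)}" using l by simp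
      moreover have "\<bar>jacobi_term \<alpha> \<beta> f n x\<bar> \<le> real (nat \<lceil>C\<rceil>) * real n powr \<delta>" if "n \<ge> 1" for n
        by (rule order_trans[OF C[OF that]]) (intro mult_right_mono real_nat_ceiling_ge powr_ge_zero)
      ultimately have "\<theta> \<in> E (s / real (Suc m)) (real (nat \<lceil>C\<rceil>))" by (auto simp: E_def \<theta>(3))
      then have "x \<in> S" unfolding S_def using \<theta>(3) by blast
      then show False using elim by simp
    qed
  qed
qed

theorem theorem2p3:
  fixes \<alpha> \<beta> p \<delta> :: real
  assumes "\<alpha> \<ge> \<beta>" and "\<beta> \<ge> - 1 / 2" and "\<alpha> > - 1 / 2"
    and "1 \<le> p" and "p < 4 * (\<alpha> + 1) / (2 * \<alpha> + 3)"
    and "0 \<le> \<delta>" and "\<delta> < (2 * \<alpha> + 2) / p - (2 * \<alpha> + 3) / 2"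
  shows "\<exists>f \<in> Lp_functions p (jacobi_measure \<alpha> \<beta>).
    (AE x\<in>{-1..<0} in lborel. f x = 0) \<and>
    (AE x\<in>{-1..1} in lborel.
      \<not> convergent (\<lambda>N. cesaro_mean \<alpha> \<beta> \<delta> f N x) \<and>
      \<not> (\<exists>L. ((\<lambda>r. riesz_mean \<alpha> \<beta> \<delta> f r x) \<longlongrightarrow> L) at_top))"
proof -
  have ab: "\<alpha> > -1" "\<beta> > -1" "\<alpha> + \<beta> > -1" using assms by auto
  define u where "u = (\<alpha> + 1) / p"
  have "(2 * \<alpha> + 2) / p = 2 * u" by (simp add: u_def)
  then have "\<delta> < 2 * u - (2 * \<alpha> + 3) / 2" using assms(7) by simp
  then have "(\<delta> + \<alpha> + 3 / 2) / 2 < u" by (simp add: field_simps)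
  \<comment> \<open>The lower limit is what the growth of the coefficients requires, the upper limit
    \<open>u\<close> what integrability requires.\<close>
  then obtain \<gamma> where \<gamma>: "(\<delta> + \<alpha> + 3 / 2) / 2 < \<gamma>" "\<gamma> < u" by (meson dense)
  have "\<gamma> > 0" using \<gamma>(1) assms by simp
  have gp: "\<gamma> * p < \<alpha> + 1" using \<gamma>(2) assms by (simp add: u_def pos_less_divide_eq)
  have "\<gamma> * 1 \<le> \<gamma> * p" using \<open>\<gamma> > 0\<close> assms by (intro mult_left_mono) auto
  then have "\<gamma> < \<alpha> + 1" using gp by simp
  have "\<delta> < 2 * \<gamma> - \<alpha> - 3 / 2" using \<gamma>(1) by simp
  note large = half_powr_coeff_large[OF ab \<open>\<gamma> > 0\<close> \<open>\<gamma> < \<alpha> + 1\<close> assms(6) this]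
  show ?thesis
  proof (intro bexI[of _ "half_powr \<gamma>"] conjI)
    show "half_powr \<gamma> \<in> Lp_functions p (jacobi_measure \<alpha> \<beta>)"
      using ab(2) gp by (rule half_powr_Lp)
    show "AE x\<in>{-1..<0} in lborel. half_powr \<gamma> x = 0" by (simp add: half_powr_def)
    show "AE x\<in>{-1..1} in lborel.
      \<not> convergent (\<lambda>N. cesaro_mean \<alpha> \<beta> \<delta> (half_powr \<gamma>) N x) \<and>
      \<not> (\<exists>L. ((\<lambda>r. riesz_mean \<alpha> \<beta> \<delta> (half_powr \<gamma>) r x) \<longlongrightarrow> L) at_top)"
      using AE_unbounded_terms[OF ab large]
    proof eventually_elim
      case (elim x)
      show ?case
      proof (intro impI conjI notI)
        assume x: "x \<in> {-1..1}"
        assume "convergent (\<lambda>N. cesaro_mean \<alpha> \<beta> \<delta> (half_powr \<gamma>) N x)"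
        from convergent_cesaro_terms[OF assms(6) this] show False using elim x by blast
      next
        assume x: "x \<in> {-1..1}"
        assume "\<exists>L. ((\<lambda>r. riesz_mean \<alpha> \<beta> \<delta> (half_powr \<gamma>) r x) \<longlongrightarrow> L) at_top"
        then obtain L where "((\<lambda>r. riesz_mean \<alpha> \<beta> \<delta> (half_powr \<gamma>) r x) \<longlongrightarrow> L) at_top" by blast
        from convergent_riesz_terms[OF assms(6) this] show False using elim x by blast
      qed
    qed
  qed
qed

end
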